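(* Let $\varphi$ be an elliptic automorphism of $\mathbb{D}$ with fixed point $a\in\mathbb{D}$, and let $\psi\in H^\infty(\mathbb{D})$ be not identically zero. Assume that the weighted composition operator $C_{\psi,\varphi}$ on $H^2(\mathbb{D})$ is not invertible. If $\varphi'(a)^n=1$ for some positive integer $n$, and $n_0$ is the smallest such integer, then the spectrum of $C_{\psi,\varphi}$ on $H^2(\mathbb{D})$ is the closure of the set $$\Lambda=\Big\{\lambda\in\mathbb{C} : \lambda^{n_0}=\prod_{k=0}^{n_0-1}\psi(\varphi_k(z))\ \text{for some } z\in\mathbb{D}\Big\}.$$ Moreover, each point in $\Lambda$ belongs to the compression spectrum of $C_{\psi,\varphi}$.
   Context: $\mathbb{D}$ is the open unit disk in $\mathbb{C}$. $H^2(\mathbb{D})$ is the Hardy-Hilbert space of analytic functions $f$ on $\mathbb{D}$ with $\|f\|^2=\sup_{0<r<1}\int_0^{2\pi}|f(re^{i\theta})|^2\frac{d\theta}{2\pi}<\infty$. $H^\infty(\mathbb{D})$ is the space of bounded analytic functions on $\mathbb{D}$. For an automorphism $\varphi$ of $\mathbb{D}$ and $\psi\in H^\infty(\mathbb{D})$, $C_{\psi,\varphi}$ is the bounded operator $C_{\psi,\varphi}f=\psi\cdot(f\circ\varphi)$. An automorphism of $\mathbb{D}$ is elliptic if it has a unique fixed point in $\mathbb{D}$. $\varphi_k$ denotes the $k$-th iterate of $\varphi$, with $\varphi_0$ the identity. The compression spectrum of a bounded operator $T$ is the set of $\lambda\in\mathbb{C}$ such that the range of $T-\lambda$ is not dense.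 *)

theory Defs
  imports "HOL-Complex_Analysis.Complex_Analysis"
begin

abbreviation unit_disk :: "complex set" where
  "unit_disk \<equiv> ball 0 1"

definition circle_mean :: "(complex \<Rightarrow> complex) \<Rightarrow> real \<Rightarrow> real" where
  "circle_mean f r =
     integral {0..2 * pi} (\<lambda>\<theta>. (norm (f (of_real r * cis \<theta>)))\<^sup>2) / (2 * pi)"

(* Functions on the disk are represented by total functions that vanish off the disk, so that
   equality of elements of the space is equality in HOL. *)
definition hardy_space :: "(complex \<Rightarrow> complex) set" where
  "hardy_space = {f. f holomorphic_on unit_disk \<and> (\<forall>z. z \<notin> unit_disk \<longrightarrow> f z = 0) \<and>
                     bdd_above (circle_mean f ` {0<..<1})}"

definition hardy_norm :: "(complex \<Rightarrow> complex) \<Rightarrow> real" where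
  "hardy_norm f = sqrt (SUP r\<in>{0<..<1}. circle_mean f r)"

definition hardy_infinity :: "(complex \<Rightarrow> complex) \<Rightarrow> bool" where
  "hardy_infinity \<psi> \<longleftrightarrow> \<psi> holomorphic_on unit_disk \<and> bounded (\<psi> ` unit_disk)"

definition disk_automorphism :: "(complex \<Rightarrow> complex) \<Rightarrow> bool" where
  "disk_automorphism \<phi> \<longleftrightarrow> \<phi> holomorphic_on unit_disk \<and> bij_betw \<phi> unit_disk unit_disk"

definition elliptic_automorphism :: "(complex \<Rightarrow> complex) \<Rightarrow> bool" where
  "elliptic_automorphism \<phi> \<longleftrightarrow> disk_automorphism \<phi> \<and> (\<exists>!a. a \<in> unit_disk \<and> \<phi> a = a)"

type_synonym fun_operator = "(complex \<Rightarrow> complex) \<Rightarrow> (complex \<Rightarrow> complex)"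

definition weighted_comp :: "(complex \<Rightarrow> complex) \<Rightarrow> (complex \<Rightarrow> complex) \<Rightarrow> fun_operator" where
  "weighted_comp \<psi> \<phi> f = (\<lambda>z. if z \<in> unit_disk then \<psi> z * f (\<phi> z) else 0)"

(* Only the values of an operator on hardy_space are meaningful. *)
definition hardy_bounded_operator :: "fun_operator \<Rightarrow> bool" where
  "hardy_bounded_operator T \<longleftrightarrow>
     (\<forall>f\<in>hardy_space. T f \<in> hardy_space) \<and>
     (\<forall>f\<in>hardy_space. \<forall>g\<in>hardy_space. T (\<lambda>z. f z + g z) = (\<lambda>z. T f z + T g z)) \<and>
     (\<forall>c. \<forall>f\<in>hardy_space. T (\<lambda>z. c * f z) = (\<lambda>z. c * T f z)) \<and>
     (\<exists>K. \<forall>f\<in>hardy_space. hardy_norm (T f) \<le> K * hardy_norm f)"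

definition hardy_invertible :: "fun_operator \<Rightarrow> bool" where
  "hardy_invertible T \<longleftrightarrow> hardy_bounded_operator T \<and>
     (\<exists>S. hardy_bounded_operator S \<and> (\<forall>f\<in>hardy_space. S (T f) = f \<and> T (S f) = f))"

definition minus_scalar :: "fun_operator \<Rightarrow> complex \<Rightarrow> fun_operator" where
  "minus_scalar T c f = (\<lambda>z. T f z - c * f z)"

definition hardy_spectrum :: "fun_operator \<Rightarrow> complex set" where
  "hardy_spectrum T = {c. \<not> hardy_invertible (minus_scalar T c)}"

definition hardy_dense :: "(complex \<Rightarrow> complex) set \<Rightarrow> bool" where
  "hardy_dense A \<longleftrightarrow>
     (\<forall>g\<in>hardy_space. \<forall>\<epsilon>>0. \<exists>h\<in>A. hardy_norm (\<lambda>z. g z - h z) < \<epsilon>)"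

definition hardy_compression_spectrum :: "fun_operator \<Rightarrow> complex set" where
  "hardy_compression_spectrum T = {c. \<not> hardy_dense (minus_scalar T c ` hardy_space)}"

end

theory Submission
  imports Defs
begin

text \<open>
  Write \<open>T\<close> for the weighted composition operator, \<open>\<omega> = \<phi>'(a)\<close>, \<open>n = n\<^sub>0\<close> and
  \<open>\<Psi>\<close> for the product of \<open>\<psi>\<close> along the first \<open>n\<close> points of an orbit. By the Schwarz lemma
  the Moebius map \<open>\<alpha>\<close> that sends \<open>a\<close> to \<open>0\<close> turns \<open>\<phi>\<close> into the rotation by \<open>\<omega>\<close>, a primitive
  \<open>n\<close>-th root of unity. Hence \<open>\<phi>\<^sub>n\<close> is the identity and \<open>T^n\<close> is multiplication by \<open>\<Psi>\<close>.
  With \<open>A = (\<Sum>k<n. c^(n-1-k) T^k)\<close> this gives \<open>A (T - c) = (T - c) A = \<Psi> - c^n\<close>, and everything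
  is read off from this factorization.

  If \<open>c\<close> is not in the closure of \<open>\<Lambda>\<close>, then \<open>\<Psi> - c^n\<close> is bounded away from zero, because the
  power map is open; division by it is then a bounded multiplication operator, and
  composing it with \<open>A\<close> inverts \<open>T - c\<close>
  (lemma \<open>hardy_invertible_minus_scalar_weighted_comp\<close>).

  If \<open>c \<in> \<Lambda>\<close>, say \<open>c^n = \<Psi>(z\<^sub>0)\<close>, then \<open>A\<close> maps the range of \<open>T - c\<close> into functions that vanish
  at \<open>z\<^sub>0\<close>, and by continuity of point evaluations the same is true of the closure of that range.
  For \<open>c \<noteq> 0\<close> and \<open>z\<^sub>0 \<noteq> a\<close> a function \<open>g\<close> that is nonzero at \<open>z\<^sub>0\<close> and zero at the other points
  of the orbit is not in this closure, as \<open>(A g)(z\<^sub>0) = c^(n-1) g(z\<^sub>0)\<close>.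
  If \<open>c \<noteq> 0\<close> and \<open>z\<^sub>0 = a\<close>, the orbit is a single point, and orders of vanishing replace values: \<open>\<Psi> - c^n\<close> is invariant under \<open>\<phi>\<close> and so vanishes at \<open>a\<close>
  to order at least \<open>n\<close>, whereas \<open>c = \<psi>(a) \<omega>^j\<close> for some \<open>j < n\<close> and \<open>A \<alpha>^j\<close> vanishes only
  to order \<open>j\<close>. For \<open>c = 0\<close> every function in the range of \<open>T\<close> vanishes at a zero of \<open>\<psi>\<close> on the orbit
  (lemma \<open>in_hardy_compression_spectrum_weighted_comp\<close>).

  Finally, near a point \<open>c\<close> where \<open>T - c\<close> is invertible all ranges of \<open>T - d\<close> are dense, so the
  closure of the compression spectrum lies in the spectrum
  (lemma \<open>closure_compression_spectrum_subset_spectrum\<close>).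

  What makes these arguments work in the Hardy space is the Poisson integral: it bounds point
  evaluations, and, together with the mean value property, it shows that \<open>T\<close> is bounded.
\<close>

section \<open>The Poisson integral and circle means\<close>

lemma cmod_of_real_cis [simp]: "0 \<le> R \<Longrightarrow> cmod (of_real R * cis t) = R"
  by (simp add: norm_mult)

text \<open>
  The right-hand side is the Poisson kernel of the disk of radius \<open>R\<close>. As the real part of a function
  holomorphic in \<open>w\<close> it has the mean value property, which is how \<open>circle_mean_comp_le\<close> uses it.
\<close>
lemma Re_cayley_quotient:
  assumes "cmod \<zeta> = R"
  shows "Re ((\<zeta> + w) / (\<zeta> - w)) = (R\<^sup>2 - (cmod w)\<^sup>2) / (cmod (\<zeta> - w))\<^sup>2"
proof -
  have "Re ((\<zeta> + w) * cnj (\<zeta> - w)) = R\<^sup>2 - (cmod w)\<^sup>2"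
    unfolding assms[symmetric] cmod_power2 by (simp add: algebra_simps power2_eq_square)
  then show ?thesis
    by (subst complex_div_cnj) (simp add: Re_divide_of_real flip: of_real_power)
qed

lemma has_integral_Cauchy_circle:
  assumes "f holomorphic_on cball 0 R" "cmod w < R"
  shows "((\<lambda>t. f (of_real R * cis t) * (of_real R * cis t) / (of_real R * cis t - w))
           has_integral (2 * of_real pi * f w)) {0..2 * pi}"
proof -
  have "((\<lambda>u. f u / (u - w)) has_contour_integral (2 * of_real pi * \<i> * f w)) (circlepath 0 R)"
    using assms by (intro Cauchy_integral_circlepath_simple) auto
  then have "((\<lambda>t. f (of_real R * cis t) / (of_real R * cis t - w) * R * \<i> * cis t)
       has_integral (2 * of_real pi * \<i> * f w)) {0..2 * pi}"
    by (simp add: circlepath_def has_contour_integral_part_circlepath_iff)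
  from has_integral_mult_right[OF this, of "-\<i>"] show ?thesis
    by (simp add: mult_ac)
qed

lemma continuous_on_comp_circle:
  assumes "continuous_on unit_disk f" "0 \<le> r" "r < 1"
  shows "continuous_on S (\<lambda>t. f (of_real r * cis t))"
  by (rule continuous_on_compose2[OF assms(1)]) (use assms in \<open>auto intro!: continuous_intros\<close>)

lemma integrable_circle_mean:
  assumes "f holomorphic_on unit_disk" "0 \<le> r" "r < 1"
  shows "(\<lambda>t. (cmod (f (of_real r * cis t)))\<^sup>2) integrable_on {0..2 * pi}"
  by (intro integrable_continuous_interval continuous_intros continuous_on_comp_circle
        holomorphic_on_imp_continuous_on assms)

text \<open>
  The function \<open>f\<^sup>2\<close> is holomorphic, so it equals its own Poisson integral; taking absolute values
  gives a bound for \<open>|f|\<^sup>2\<close>. The Poisson formula itself is a single use of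
  Cauchy's formula: the factor \<open>(R\<^sup>2 - |w|\<^sup>2) / (R\<^sup>2 - cnj w * u)\<close> is holomorphic in \<open>u\<close>, equals \<open>1\<close> at
  \<open>u = w\<close>, and on the circle turns the modulus of the Cauchy kernel into the Poisson kernel.
\<close>
lemma norm_square_le_Poisson:
  assumes f: "f holomorphic_on unit_disk" and R: "0 < R" "R < 1" and w: "cmod w < R"
  shows "(cmod (f w))\<^sup>2 \<le> integral {0..2 * pi}
           (\<lambda>t. (cmod (f (of_real R * cis t)))\<^sup>2 *
                Re ((of_real R * cis t + w) / (of_real R * cis t - w))) / (2 * pi)"
proof -
  define k where "k u = (f u)\<^sup>2 * of_real (R\<^sup>2 - (cmod w)\<^sup>2) / (of_real (R\<^sup>2) - cnj w * u)" for u
  have nz: "of_real (R\<^sup>2) - cnj w * u \<noteq> 0" if "cmod u \<le> R" for u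
  proof
    assume "of_real (R\<^sup>2) - cnj w * u = 0"
    then have "R\<^sup>2 = cmod w * cmod u"
      by (metis complex_mod_cnj eq_iff_diff_eq_0 norm_mult norm_of_real abs_power2)
    also have "\<dots> \<le> cmod w * R"
      using that by (intro mult_left_mono) auto
    also have "\<dots> < R * R"
      using w R by simp
    finally show False by (simp add: power2_eq_square)
  qed
  have fR: "f holomorphic_on cball 0 R"
    using f by (rule holomorphic_on_subset) (use R in auto)
  have "k holomorphic_on cball 0 R"
    unfolding k_def using nz by (intro holomorphic_intros fR) auto
  from has_integral_Cauchy_circle[OF this w]
  have I: "((\<lambda>t. k (of_real R * cis t) * (of_real R * cis t) / (of_real R * cis t - w))
           has_integral (2 * of_real pi * k w)) {0..2 * pi}" .
  have kw: "k w = (f w)\<^sup>2"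
  proof -
    have "of_real (R\<^sup>2) - cnj w * w = of_real (R\<^sup>2 - (cmod w)\<^sup>2)"
      by (simp add: mult.commute flip: complex_norm_square)
    with nz[of w] w show ?thesis unfolding k_def by simp
  qed
  have eq: "cmod (k \<zeta> * \<zeta> / (\<zeta> - w)) = (cmod (f \<zeta>))\<^sup>2 * Re ((\<zeta> + w) / (\<zeta> - w))"
    if "cmod \<zeta> = R" for \<zeta>
  proof -
    have "of_real (R\<^sup>2) - cnj w * \<zeta> = \<zeta> * cnj (\<zeta> - w)"
      using that by (simp add: algebra_simps flip: complex_norm_square)
    moreover have "\<zeta> \<noteq> w" "\<zeta> \<noteq> 0" using that w R by auto
    moreover have "(cmod w)\<^sup>2 \<le> R\<^sup>2" using w by (simp add: power_mono)
    ultimately show ?thesis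
      by (simp add: k_def Re_cayley_quotient[OF that] norm_mult norm_divide norm_power
          power2_eq_square del: complex_cnj_diff of_real_diff)
  qed
  have cont: "continuous_on {0..2*pi} (\<lambda>t. (cmod (f (of_real R * cis t)))\<^sup>2 *
                Re ((of_real R * cis t + w) / (of_real R * cis t - w)))"
  proof -
    have "of_real R * cis t - w \<noteq> 0" for t
      using w R by (metis cmod_of_real_cis eq_iff_diff_eq_0 less_eq_real_def less_irrefl)
    then show ?thesis
      using R by (intro continuous_intros continuous_on_comp_circle holomorphic_on_imp_continuous_on f) auto
  qed
  have "2 * pi * (cmod (f w))\<^sup>2 = cmod (2 * of_real pi * k w)"
    by (simp add: kw norm_mult norm_power)
  also have "\<dots> \<le> integral {0..2*pi} (\<lambda>t. (cmod (f (of_real R * cis t)))\<^sup>2 *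
                Re ((of_real R * cis t + w) / (of_real R * cis t - w)))"
    unfolding integral_unique[OF I, symmetric]
    using R by (intro integral_norm_bound_integral has_integral_integrable[OF I]
          integrable_continuous_interval[OF cont]) (simp add: eq)
  finally show ?thesis by (simp add: field_simps)
qed

lemma Re_cayley_quotient_le:
  assumes "0 < R" "cmod \<zeta> = R" "cmod w < R"
  shows "Re ((\<zeta> + w) / (\<zeta> - w)) \<le> (R + cmod w) / (R - cmod w)"
proof -
  have "Re ((\<zeta> + w) / (\<zeta> - w)) \<le> cmod (\<zeta> + w) / cmod (\<zeta> - w)"
    using complex_Re_le_cmod[of "(\<zeta> + w) / (\<zeta> - w)"] by (simp add: norm_divide)
  also have "\<dots> \<le> (R + cmod w) / (R - cmod w)"
    using assms norm_triangle_ineq[of \<zeta> w] norm_triangle_ineq2[of \<zeta> w]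
    by (intro frac_le) auto
  finally show ?thesis .
qed

lemma integral_Poisson_le:
  assumes f: "f holomorphic_on unit_disk" and R: "0 < R" "R < 1" and w: "cmod w < R"
  shows "integral {0..2 * pi} (\<lambda>t. (cmod (f (of_real R * cis t)))\<^sup>2 *
           Re ((of_real R * cis t + w) / (of_real R * cis t - w))) / (2 * pi)
         \<le> (R + cmod w) / (R - cmod w) * circle_mean f R"
proof -
  have nz: "of_real R * cis t - w \<noteq> 0" for t
    using w R by (metis cmod_of_real_cis eq_iff_diff_eq_0 less_eq_real_def less_irrefl)
  have "integral {0..2 * pi} (\<lambda>t. (cmod (f (of_real R * cis t)))\<^sup>2 *
           Re ((of_real R * cis t + w) / (of_real R * cis t - w)))
      \<le> integral {0..2 * pi} (\<lambda>t. (cmod (f (of_real R * cis t)))\<^sup>2 * ((R + cmod w) / (R - cmod w)))"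
    using R nz
    by (intro integral_le integrable_continuous_interval continuous_intros mult_left_mono
          Re_cayley_quotient_le continuous_on_comp_circle holomorphic_on_imp_continuous_on f w) auto
  also have "\<dots> = (R + cmod w) / (R - cmod w) * (circle_mean f R * (2 * pi))"
    unfolding circle_mean_def by (subst integral_mult_left) simp
  finally show ?thesis
    by (simp add: pos_divide_le_eq mult_ac)
qed

lemma norm_square_le_circle_mean:
  assumes "f holomorphic_on unit_disk" "0 < R" "R < 1" "cmod w < R"
  shows "(cmod (f w))\<^sup>2 \<le> (R + cmod w) / (R - cmod w) * circle_mean f R"
  using norm_square_le_Poisson[OF assms] integral_Poisson_le[OF assms] by linarith

text \<open>
  Littlewood's subordination argument. The Poisson bound at the points \<open>\<phi>(r e^{is})\<close> is integrated
  over \<open>s\<close>; after exchanging the two integrals, the mean value property of the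
  Poisson kernel replaces \<open>\<phi>(r e^{is})\<close> by \<open>\<phi>(0)\<close>, where the kernel is bounded.
\<close>
lemma circle_mean_comp_le:
  assumes f: "f holomorphic_on unit_disk" and p: "\<phi> holomorphic_on unit_disk"
    and pR: "\<And>z. cmod z \<le> r \<Longrightarrow> cmod (\<phi> z) < R"
    and r: "0 < r" "r < 1" and R: "0 < R" "R < 1"
  shows "circle_mean (\<lambda>z. f (\<phi> z)) r \<le> (R + cmod (\<phi> 0)) / (R - cmod (\<phi> 0)) * circle_mean f R"
proof -
  define P where "P t w = Re ((of_real R * cis t + w) / (of_real R * cis t - w))" for t w
  define F where "F t = (cmod (f (of_real R * cis t)))\<^sup>2" for t
  define g where "g s = \<phi> (of_real r * cis s)" for s
  have gR: "cmod (g s) < R" for s unfolding g_def using r by (intro pR) auto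
  have nz: "of_real R * cis t - w \<noteq> 0" if "cmod w < R" for t w
    using that R by (metis cmod_of_real_cis eq_iff_diff_eq_0 less_eq_real_def less_irrefl)
  have cF: "continuous_on S F" for S unfolding F_def
    using R by (intro continuous_intros continuous_on_comp_circle holomorphic_on_imp_continuous_on f) auto
  have cg: "continuous_on S g" for S unfolding g_def
    using r by (intro continuous_on_comp_circle holomorphic_on_imp_continuous_on p) auto
  have c2: "continuous_on S (\<lambda>(s,t). F t * P t (g s))" for S
    unfolding P_def split_def using nz[OF gR]
    by (intro continuous_intros continuous_on_compose2[OF cF[of UNIV]]
         continuous_on_compose2[OF cg[of UNIV]]) auto
  have mean: "integral {0..2*pi} (\<lambda>s. P t (g s)) = 2 * pi * P t (\<phi> 0)" for t
  proof -
    have sub: "cball 0 r \<subseteq> (unit_disk::complex set)" using r by auto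
    have "(\<lambda>z. (of_real R * cis t + \<phi> z) / (of_real R * cis t - \<phi> z)) holomorphic_on cball 0 r"
      using nz pR by (intro holomorphic_intros holomorphic_on_subset[OF p sub]) auto
    from has_integral_Cauchy_circle[OF this, of 0] r
    have "((\<lambda>s. (of_real R * cis t + g s) / (of_real R * cis t - g s)) has_integral
        2 * of_real pi * ((of_real R * cis t + \<phi> 0) / (of_real R * cis t - \<phi> 0))) {0..2 * pi}"
      by (simp add: g_def)
    then have "((\<lambda>s. (of_real R * cis t + g s) / (of_real R * cis t - g s)) has_integral
        of_real (2 * pi) * ((of_real R * cis t + \<phi> 0) / (of_real R * cis t - \<phi> 0))) {0..2 * pi}"
      by simp
    from integral_unique[OF has_integral_Re[OF this]] show ?thesis
      unfolding P_def by (simp only: Re_complex_of_real Im_complex_of_real times_complex.sel mult_zero_left diff_zero)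
  qed
  have "circle_mean (\<lambda>z. f (\<phi> z)) r = integral {0..2*pi} (\<lambda>s. (cmod (f (g s)))\<^sup>2) / (2 * pi)"
    by (simp add: circle_mean_def g_def)
  also have "\<dots> \<le> integral {0..2*pi} (\<lambda>s. integral {0..2*pi} (\<lambda>t. F t * P t (g s)) / (2 * pi)) / (2 * pi)"
  proof (intro divide_right_mono integral_le integrable_continuous_interval)
    show "continuous_on {0..2*pi} (\<lambda>s. (cmod (f (g s)))\<^sup>2)"
    proof (intro continuous_intros continuous_on_compose2[OF holomorphic_on_imp_continuous_on[OF f]] cg)
      show "g ` {0..2*pi} \<subseteq> unit_disk" using less_trans[OF gR R(2)] by auto
    qed
    show "continuous_on {0..2*pi} (\<lambda>s. integral {0..2*pi} (\<lambda>t. F t * P t (g s)) / (2 * pi))"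
      using integral_continuous_on_param[of "{0..2*pi}" 0 "2*pi" "\<lambda>s t. F t * P t (g s)"] c2
      by (intro continuous_intros) auto
    show "(cmod (f (g s)))\<^sup>2 \<le> integral {0..2*pi} (\<lambda>t. F t * P t (g s)) / (2 * pi)" for s
      using norm_square_le_Poisson[OF f R gR[of s]] by (simp add: F_def P_def)
  qed simp
  also have "\<dots> = integral {0..2*pi} (\<lambda>s. integral {0..2*pi} (\<lambda>t. F t * P t (g s))) / (2 * pi) / (2 * pi)"
    by simp
  also have "integral {0..2*pi} (\<lambda>s. integral {0..2*pi} (\<lambda>t. F t * P t (g s)))
       = integral {0..2*pi} (\<lambda>t. integral {0..2*pi} (\<lambda>s. F t * P t (g s)))"
    using integral_swap_continuous[OF c2, of 0 "2*pi" 0 "2*pi"] by simp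
  also have "\<dots> / (2 * pi) / (2 * pi) = integral {0..2*pi} (\<lambda>t. F t * P t (\<phi> 0)) / (2 * pi)"
  proof -
    have "(\<lambda>t. integral {0..2*pi} (\<lambda>s. F t * P t (g s))) = (\<lambda>t. F t * P t (\<phi> 0) * (2 * pi))"
      by (simp add: mean fun_eq_iff)
    then show ?thesis by simp
  qed
  also have "\<dots> \<le> (R + cmod (\<phi> 0)) / (R - cmod (\<phi> 0)) * circle_mean f R"
    using integral_Poisson_le[OF f R pR[of 0]] r by (simp add: F_def P_def)
  finally show ?thesis .
qed

section \<open>The Hardy space and weighted composition operators\<close>

lemma hardy_spaceI:
  assumes "f holomorphic_on unit_disk" "\<And>z. z \<notin> unit_disk \<Longrightarrow> f z = 0"
    and "\<And>r. 0 < r \<Longrightarrow> r < 1 \<Longrightarrow> circle_mean f r \<le> K"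
  shows "f \<in> hardy_space"
proof -
  have "bdd_above (circle_mean f ` {0<..<1})"
    using assms(3) by (intro bdd_aboveI[of _ K]) auto
  with assms(1,2) show ?thesis by (simp add: hardy_space_def)
qed

lemma hardy_spaceD:
  assumes "f \<in> hardy_space"
  shows "f holomorphic_on unit_disk" "z \<notin> unit_disk \<Longrightarrow> f z = 0"
  using assms by (auto simp: hardy_space_def)

lemma circle_mean_nonneg: "0 \<le> circle_mean f r"
proof (cases "(\<lambda>t. (cmod (f (of_real r * cis t)))\<^sup>2) integrable_on {0..2 * pi}")
  case True
  then show ?thesis
    unfolding circle_mean_def by (intro divide_nonneg_nonneg integral_nonneg) auto
qed (simp add: circle_mean_def not_integrable_integral)

lemma circle_mean_le_hardy_norm:
  assumes "f \<in> hardy_space" "0 < r" "r < 1"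
  shows "circle_mean f r \<le> (hardy_norm f)\<^sup>2"
proof -
  have le: "circle_mean f r \<le> (SUP r\<in>{0<..<1}. circle_mean f r)"
    using assms by (intro cSUP_upper) (auto simp: hardy_space_def)
  with circle_mean_nonneg[of f r] show ?thesis
    by (simp add: hardy_norm_def)
qed

lemma hardy_norm_le:
  assumes "\<And>r. 0 < r \<Longrightarrow> r < 1 \<Longrightarrow> circle_mean f r \<le> K\<^sup>2" "0 \<le> K"
  shows "hardy_norm f \<le> K"
proof -
  have "(SUP r\<in>{0<..<1}. circle_mean f r) \<le> K\<^sup>2"
    using assms by (intro cSUP_least) auto
  then show ?thesis
    unfolding hardy_norm_def using assms(2) by (simp add: real_le_lsqrt real_sqrt_le_iff)
qed

lemma hardy_norm_nonneg:
  assumes "f \<in> hardy_space"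
  shows "0 \<le> hardy_norm f"
proof -
  have "circle_mean f (1/2) \<le> (SUP r\<in>{0<..<1}. circle_mean f r)"
    using assms by (intro cSUP_upper) (auto simp: hardy_space_def)
  with circle_mean_nonneg[of f "1/2"] show ?thesis
    by (simp add: hardy_norm_def)
qed

text \<open>
  Pointwise domination gives the norm estimates for sums with \<open>c = d = 2\<close> and for
  products with a bounded function with \<open>d = 0\<close>.
\<close>
lemma circle_mean_le_combination:
  assumes "f holomorphic_on unit_disk" "g holomorphic_on unit_disk" "h holomorphic_on unit_disk"
    and r: "0 < r" "r < 1"
    and le: "\<And>z. z \<in> unit_disk \<Longrightarrow> (cmod (h z))\<^sup>2 \<le> c * (cmod (f z))\<^sup>2 + d * (cmod (g z))\<^sup>2"
  shows "circle_mean h r \<le> c * circle_mean f r + d * circle_mean g r"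
proof -
  note int = integrable_circle_mean[OF _ less_imp_le[OF r(1)] r(2)]
  have "integral {0..2 * pi} (\<lambda>t. (cmod (h (of_real r * cis t)))\<^sup>2)
     \<le> integral {0..2 * pi} (\<lambda>t. c * (cmod (f (of_real r * cis t)))\<^sup>2
          + d * (cmod (g (of_real r * cis t)))\<^sup>2)"
    using r by (intro integral_le le integrable_add integrable_on_mult_right int assms) auto
  also have "\<dots> = c * integral {0..2 * pi} (\<lambda>t. (cmod (f (of_real r * cis t)))\<^sup>2)
          + d * integral {0..2 * pi} (\<lambda>t. (cmod (g (of_real r * cis t)))\<^sup>2)"
    by (subst integral_add) (auto intro!: integrable_on_mult_right int assms)
  finally show ?thesis
    by (simp add: circle_mean_def divide_simps)
qed

lemma cmod_add_square_le: "(cmod (x + y))\<^sup>2 \<le> 2 * (cmod x)\<^sup>2 + 2 * (cmod y)\<^sup>2"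
proof -
  have "(cmod (x + y))\<^sup>2 \<le> (cmod x + cmod y)\<^sup>2"
    by (simp add: power_mono norm_triangle_ineq)
  also have "\<dots> \<le> 2 * (cmod x)\<^sup>2 + 2 * (cmod y)\<^sup>2"
    using sum_squares_bound[of "cmod x" "cmod y"] by (simp add: power2_sum)
  finally show ?thesis .
qed

text \<open>
  The constant \<open>2\<close> instead of the triangle inequality comes from squaring, and it is good enough
  because boundedness of operators does not depend on constants.
\<close>
lemma
  assumes f: "f \<in> hardy_space" and g: "g \<in> hardy_space"
  shows hardy_space_add: "(\<lambda>z. f z + g z) \<in> hardy_space"
    and hardy_norm_add_le: "hardy_norm (\<lambda>z. f z + g z) \<le> 2 * (hardy_norm f + hardy_norm g)"
proof -
  note D = hardy_spaceD[OF f] hardy_spaceD[OF g]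
  have le: "circle_mean (\<lambda>z. f z + g z) r \<le> (2 * (hardy_norm f + hardy_norm g))\<^sup>2"
    if r: "0 < r" "r < 1" for r
  proof -
    have "circle_mean (\<lambda>z. f z + g z) r \<le> 2 * circle_mean f r + 2 * circle_mean g r"
      by (intro circle_mean_le_combination holomorphic_intros D r cmod_add_square_le)
    also have "\<dots> \<le> 2 * (hardy_norm f)\<^sup>2 + 2 * (hardy_norm g)\<^sup>2"
      using circle_mean_le_hardy_norm[OF f r] circle_mean_le_hardy_norm[OF g r] by simp
    also have "\<dots> \<le> (2 * (hardy_norm f + hardy_norm g))\<^sup>2"
      using mult_nonneg_nonneg[OF hardy_norm_nonneg[OF f] hardy_norm_nonneg[OF g]]
      by (simp add: power2_eq_square algebra_simps)
    finally show ?thesis .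
  qed
  show "(\<lambda>z. f z + g z) \<in> hardy_space"
    by (rule hardy_spaceI[OF _ _ le]) (auto intro!: holomorphic_intros D simp: D)
  show "hardy_norm (\<lambda>z. f z + g z) \<le> 2 * (hardy_norm f + hardy_norm g)"
    by (rule hardy_norm_le[OF le]) (simp_all add: hardy_norm_nonneg f g)
qed

lemma
  assumes f: "f \<in> hardy_space"
  shows hardy_space_cmult: "(\<lambda>z. c * f z) \<in> hardy_space"
    and hardy_norm_cmult_le: "hardy_norm (\<lambda>z. c * f z) \<le> cmod c * hardy_norm f"
proof -
  note D = hardy_spaceD[OF f]
  have le: "circle_mean (\<lambda>z. c * f z) r \<le> (cmod c * hardy_norm f)\<^sup>2"
    if r: "0 < r" "r < 1" for r
    using circle_mean_le_hardy_norm[OF f r]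
    by (simp add: circle_mean_def norm_mult power_mult_distrib mult_left_mono flip: times_divide_eq_right)
  show "(\<lambda>z. c * f z) \<in> hardy_space"
    by (rule hardy_spaceI[OF _ _ le]) (auto intro!: holomorphic_intros D simp: D)
  show "hardy_norm (\<lambda>z. c * f z) \<le> cmod c * hardy_norm f"
    by (rule hardy_norm_le[OF le]) (simp_all add: hardy_norm_nonneg f)
qed

lemma hardy_space_zero: "(\<lambda>z. 0) \<in> hardy_space"
  by (rule hardy_spaceI[where K = 0]) (auto simp: circle_mean_def)

lemma hardy_space_diff:
  assumes "f \<in> hardy_space" "g \<in> hardy_space"
  shows "(\<lambda>z. f z - g z) \<in> hardy_space"
  using hardy_space_add[OF assms(1) hardy_space_cmult[OF assms(2), of "-1"]] by simp

lemma hardy_space_bounded_holomorphic: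
  assumes "hardy_infinity f"
  shows "(\<lambda>z. if z \<in> unit_disk then f z else 0) \<in> hardy_space"
proof -
  obtain M where M: "cmod (f z) \<le> M" if "z \<in> unit_disk" for z
    using assms by (meson bounded_iff hardy_infinity_def imageI)
  have hol: "(\<lambda>z. if z \<in> unit_disk then f z else 0) holomorphic_on unit_disk"
    using assms by (subst holomorphic_cong[OF refl, where g = f]) (auto simp: hardy_infinity_def)
  have "circle_mean (\<lambda>z. if z \<in> unit_disk then f z else 0) r \<le> M\<^sup>2" if "0 < r" "r < 1" for r
  proof -
    have "circle_mean (\<lambda>z. if z \<in> unit_disk then f z else 0) r \<le>
        M\<^sup>2 * circle_mean (\<lambda>z. 1) r + 0 * circle_mean (\<lambda>z. 1) r"
      by (rule circle_mean_le_combination) (use that hol M in \<open>auto intro!: power_mono holomorphic_intros\<close>)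
    then show ?thesis by (simp add: circle_mean_def)
  qed
  then show ?thesis by (intro hardy_spaceI[OF hol]) auto
qed

text \<open>
  Point evaluations are continuous on the Hardy space, uniformly on compact subsets of the disk:
  this carries information from the closure of a range back to values.
\<close>
lemma norm_le_hardy_norm_on_compact:
  assumes "compact K" "K \<subseteq> unit_disk"
  obtains C where "0 < C" "\<And>f z. f \<in> hardy_space \<Longrightarrow> z \<in> K \<Longrightarrow> cmod (f z) \<le> C * hardy_norm f"
proof -
  obtain s where s: "s < 1" "\<And>z. z \<in> K \<Longrightarrow> cmod z \<le> s" "0 \<le> s"
  proof (cases "K = {}")
    case True then show ?thesis by (intro that[of 0]) auto
  next
    case False
    have "continuous_on K cmod" by (intro continuous_intros)
    from continuous_attains_sup[OF assms(1) False this] obtain x where "x \<in> K" "\<forall>y\<in>K. cmod y \<le> cmod x"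
      by auto
    with assms show ?thesis by (intro that[of "cmod x"]) auto
  qed
  define R where "R = (1 + s) / 2"
  have R: "0 < R" "R < 1" "s < R" using s by (auto simp: R_def)
  define C where "C = (R + s) / (R - s)"
  have C: "0 < C" using R s by (simp add: C_def)
  show thesis
  proof (rule that[of "sqrt C"])
    fix f z assume f: "f \<in> hardy_space" and z: "z \<in> K"
    have zs: "cmod z \<le> s" "cmod z < R" using s(2)[OF z] R by auto
    have "(R + cmod z) / (R - cmod z) \<le> C"
      unfolding C_def by (rule frac_le) (use R zs s(3) in linarith)+
    have "(cmod (f z))\<^sup>2 \<le> (R + cmod z) / (R - cmod z) * circle_mean f R"
      by (intro norm_square_le_circle_mean hardy_spaceD f R zs)
    also have "\<dots> \<le> C * (hardy_norm f)\<^sup>2"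
      using \<open>_ \<le> C\<close> C R by (intro mult_mono circle_mean_le_hardy_norm f circle_mean_nonneg) auto
    finally have "(cmod (f z))\<^sup>2 \<le> (sqrt C * hardy_norm f)\<^sup>2"
      using C by (simp add: power_mult_distrib)
    then show "cmod (f z) \<le> sqrt C * hardy_norm f"
      by (rule power2_le_imp_le) (simp add: C less_imp_le hardy_norm_nonneg[OF f])
  qed (use C in auto)
qed

text \<open>
  The constant in \<open>circle_mean_comp_le\<close> depends only on \<open>R\<close> and \<open>|\<phi>(0)|\<close>, and it stays bounded for
  \<open>(1 + |\<phi>(0)|) / 2 \<le> R < 1\<close>. Such an \<open>R\<close> can be chosen for each radius \<open>r\<close>, as \<open>\<phi>\<close> maps the closed
  disk of radius \<open>r\<close> into a compact subset of the unit disk.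
\<close>
lemma hardy_bounded_operator_weighted_comp:
  assumes psi: "hardy_infinity \<psi>" and p: "\<phi> holomorphic_on unit_disk" and self: "\<phi> ` unit_disk \<subseteq> unit_disk"
  shows "hardy_bounded_operator (weighted_comp \<psi> \<phi>)"
proof -
  obtain M where M: "cmod (\<psi> z) \<le> M" if "z \<in> unit_disk" for z
    using psi by (meson bounded_iff hardy_infinity_def imageI)
  have M0: "0 \<le> M" using norm_ge_zero[of "\<psi> 0"] M[of 0] by (simp del: norm_ge_zero)
  define b where "b = cmod (\<phi> 0)"
  have b: "0 \<le> b" "b < 1" using self by (auto simp: b_def image_subset_iff)
  define K where "K = M\<^sup>2 * (4 / (1 - b))"
  have K: "0 \<le> K" using b by (simp add: K_def)
  have hol: "weighted_comp \<psi> \<phi> f holomorphic_on unit_disk" if "f \<in> hardy_space" for f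
  proof -
    have "(\<lambda>z. \<psi> z * f (\<phi> z)) holomorphic_on unit_disk"
      using psi unfolding hardy_infinity_def
      by (intro holomorphic_intros holomorphic_on_compose_gen[OF p hardy_spaceD(1)[OF that] self, unfolded o_def]) auto
    then show ?thesis by (rule holomorphic_transform) (simp add: weighted_comp_def)
  qed
  have mean: "circle_mean (weighted_comp \<psi> \<phi> f) r \<le> (sqrt K * hardy_norm f)\<^sup>2"
    if f: "f \<in> hardy_space" and r: "0 < r" "r < 1" for f r
  proof -
    have sub: "cball 0 r \<subseteq> (unit_disk::complex set)" using r by auto
    have "continuous_on (cball 0 r) (\<lambda>z. cmod (\<phi> z))"
      by (intro continuous_intros holomorphic_on_imp_continuous_on holomorphic_on_subset[OF p sub])
    from continuous_attains_sup[OF _ _ this] r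
    obtain z0 where z0: "cmod z0 \<le> r" "\<And>z. cmod z \<le> r \<Longrightarrow> cmod (\<phi> z) \<le> cmod (\<phi> z0)"
      by auto
    have m1: "cmod (\<phi> z0) < 1" using z0(1) r self by (auto simp: image_subset_iff)
    define R where "R = (1 + max (cmod (\<phi> z0)) b) / 2"
    have R: "0 < R" "R < 1" "(1 + b) / 2 \<le> R" using b m1 by (auto simp: R_def)
    have pR: "cmod (\<phi> z) < R" if "cmod z \<le> r" for z
      using z0(2)[OF that] m1 b by (auto simp: R_def)
    have fp: "(\<lambda>z. f (\<phi> z)) holomorphic_on unit_disk"
      by (rule holomorphic_on_compose_gen[OF p hardy_spaceD(1)[OF f] self, unfolded o_def])
    have "circle_mean (weighted_comp \<psi> \<phi> f) r
        \<le> M\<^sup>2 * circle_mean (\<lambda>z. f (\<phi> z)) r + 0 * circle_mean (\<lambda>z. f (\<phi> z)) r"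
    proof (rule circle_mean_le_combination[OF fp fp hol[OF f] r])
      fix z :: complex assume z: "z \<in> unit_disk"
      have "(cmod (weighted_comp \<psi> \<phi> f z))\<^sup>2 = (cmod (\<psi> z))\<^sup>2 * (cmod (f (\<phi> z)))\<^sup>2"
        using z by (simp add: weighted_comp_def norm_mult power_mult_distrib)
      also have "\<dots> \<le> M\<^sup>2 * (cmod (f (\<phi> z)))\<^sup>2"
        by (intro mult_right_mono power_mono M z) auto
      finally show "(cmod (weighted_comp \<psi> \<phi> f z))\<^sup>2 \<le> M\<^sup>2 * (cmod (f (\<phi> z)))\<^sup>2 + 0 * (cmod (f (\<phi> z)))\<^sup>2"
        by simp
    qed
    also have "\<dots> = M\<^sup>2 * circle_mean (\<lambda>z. f (\<phi> z)) r" by simp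
    also have "\<dots> \<le> M\<^sup>2 * ((R + b) / (R - b) * circle_mean f R)"
      unfolding b_def
      by (intro mult_left_mono circle_mean_comp_le hardy_spaceD(1)[OF f] p pR r R) auto
    also have "\<dots> \<le> M\<^sup>2 * (4 / (1 - b) * (hardy_norm f)\<^sup>2)"
    proof (intro mult_left_mono mult_mono circle_mean_le_hardy_norm f R circle_mean_nonneg)
      have "(R + b) / (R - b) \<le> 2 / ((1 - b) / 2)"
        using R b by (intro frac_le) (auto simp: field_simps)
      then show "(R + b) / (R - b) \<le> 4 / (1 - b)" by simp
    qed (use b in auto)
    also have "\<dots> = (sqrt K * hardy_norm f)\<^sup>2"
      using K by (simp add: power_mult_distrib K_def)
    finally show ?thesis .
  qed
  show ?thesis
    unfolding hardy_bounded_operator_def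
  proof (intro conjI ballI allI exI)
    fix f assume f: "f \<in> hardy_space"
    show "weighted_comp \<psi> \<phi> f \<in> hardy_space"
      by (rule hardy_spaceI[OF hol[OF f] _ mean[OF f]]) (auto simp: weighted_comp_def)
    show "hardy_norm (weighted_comp \<psi> \<phi> f) \<le> sqrt K * hardy_norm f"
      by (rule hardy_norm_le[OF mean[OF f]]) (use K hardy_norm_nonneg[OF f] in auto)
  qed (auto simp: weighted_comp_def fun_eq_iff algebra_simps)
qed

section \<open>Bounded operators and their spectra\<close>

lemma hardy_bounded_operatorD:
  assumes "hardy_bounded_operator T"
  shows "f \<in> hardy_space \<Longrightarrow> T f \<in> hardy_space"
    and "f \<in> hardy_space \<Longrightarrow> g \<in> hardy_space \<Longrightarrow> T (\<lambda>z. f z + g z) = (\<lambda>z. T f z + T g z)"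
    and "f \<in> hardy_space \<Longrightarrow> T (\<lambda>z. c * f z) = (\<lambda>z. c * T f z)"
  using assms by (auto simp: hardy_bounded_operator_def)

lemma hardy_bounded_operatorI:
  assumes "\<And>f. f \<in> hardy_space \<Longrightarrow> T f \<in> hardy_space"
    and "\<And>f g. f \<in> hardy_space \<Longrightarrow> g \<in> hardy_space \<Longrightarrow> T (\<lambda>z. f z + g z) = (\<lambda>z. T f z + T g z)"
    and "\<And>c f. f \<in> hardy_space \<Longrightarrow> T (\<lambda>z. c * f z) = (\<lambda>z. c * T f z)"
    and "\<And>f. f \<in> hardy_space \<Longrightarrow> hardy_norm (T f) \<le> K * hardy_norm f"
  shows "hardy_bounded_operator T"
  using assms unfolding hardy_bounded_operator_def by blast

lemma hardy_bounded_operator_bound: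
  assumes "hardy_bounded_operator T"
  obtains K where "0 < K" "\<And>f. f \<in> hardy_space \<Longrightarrow> hardy_norm (T f) \<le> K * hardy_norm f"
proof -
  obtain K where K: "hardy_norm (T f) \<le> K * hardy_norm f" if "f \<in> hardy_space" for f
    using assms unfolding hardy_bounded_operator_def by blast
  show thesis
  proof (rule that[of "max K 1"])
    fix f assume f: "f \<in> hardy_space"
    have "K * hardy_norm f \<le> max K 1 * hardy_norm f"
      by (intro mult_right_mono hardy_norm_nonneg f) auto
    with K[OF f] show "hardy_norm (T f) \<le> max K 1 * hardy_norm f" by linarith
  qed auto
qed

lemma hardy_bounded_operator_diff:
  assumes "hardy_bounded_operator T" "f \<in> hardy_space" "g \<in> hardy_space"
  shows "T (\<lambda>z. f z - g z) = (\<lambda>z. T f z - T g z)"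
  using hardy_bounded_operatorD(2)[OF assms(1,2) hardy_space_cmult[OF assms(3), of "-1"]]
    hardy_bounded_operatorD(3)[OF assms(1,3), of "-1"] by simp

lemma hardy_bounded_operator_id: "hardy_bounded_operator (\<lambda>f. f)"
  unfolding hardy_bounded_operator_def by (auto intro!: exI[of _ 1])

lemma hardy_bounded_operator_zero: "hardy_bounded_operator (\<lambda>f z. 0)"
proof -
  have "hardy_norm (\<lambda>z. 0) \<le> 0"
    by (rule hardy_norm_le) (auto simp: circle_mean_def)
  then show ?thesis
    unfolding hardy_bounded_operator_def by (auto intro!: exI[of _ 0] hardy_space_zero)
qed

lemma hardy_bounded_operator_comp:
  assumes T: "hardy_bounded_operator T" and S: "hardy_bounded_operator S"
  shows "hardy_bounded_operator (\<lambda>f. T (S f))"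
proof -
  obtain K L where K: "0 < K" "\<And>f. f \<in> hardy_space \<Longrightarrow> hardy_norm (T f) \<le> K * hardy_norm f"
    and L: "0 < L" "\<And>f. f \<in> hardy_space \<Longrightarrow> hardy_norm (S f) \<le> L * hardy_norm f"
    by (metis T S hardy_bounded_operator_bound)
  note [simp] = hardy_bounded_operatorD[OF T] hardy_bounded_operatorD[OF S]
  have "hardy_norm (T (S f)) \<le> (K * L) * hardy_norm f" if "f \<in> hardy_space" for f
    using order_trans[OF K(2)[of "S f"] mult_left_mono[OF L(2)[OF that], of K]] K(1) that
    by (simp add: mult.assoc)
  then show ?thesis by (intro hardy_bounded_operatorI[where K = "K * L"]) simp_all
qed

lemma hardy_bounded_operator_funpow:
  assumes "hardy_bounded_operator T"
  shows "hardy_bounded_operator (T ^^ k)"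
proof (induction k)
  case (Suc k)
  then show ?case
    using hardy_bounded_operator_comp[OF assms Suc] by (simp add: o_def)
qed (simp add: id_def hardy_bounded_operator_id)

lemma hardy_bounded_operator_add:
  assumes T: "hardy_bounded_operator T" and S: "hardy_bounded_operator S"
  shows "hardy_bounded_operator (\<lambda>f z. T f z + S f z)"
proof -
  obtain K L where K: "\<And>f. f \<in> hardy_space \<Longrightarrow> hardy_norm (T f) \<le> K * hardy_norm f"
    and L: "\<And>f. f \<in> hardy_space \<Longrightarrow> hardy_norm (S f) \<le> L * hardy_norm f"
    by (metis T S hardy_bounded_operator_bound)
  note D = hardy_bounded_operatorD[OF T] hardy_bounded_operatorD[OF S]
  have "hardy_norm (\<lambda>z. T f z + S f z) \<le> (2 * (K + L)) * hardy_norm f" if "f \<in> hardy_space" for f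
    using hardy_norm_add_le[OF D(1)[OF that] D(4)[OF that]] K[OF that] L[OF that]
    by (simp add: algebra_simps)
  then show ?thesis
    by (intro hardy_bounded_operatorI[where K = "2 * (K + L)"] hardy_space_add D(1,4))
      (simp_all add: D distrib_left add_ac)
qed

lemma hardy_bounded_operator_cmult:
  assumes T: "hardy_bounded_operator T"
  shows "hardy_bounded_operator (\<lambda>f z. c * T f z)"
proof -
  obtain K where K: "\<And>f. f \<in> hardy_space \<Longrightarrow> hardy_norm (T f) \<le> K * hardy_norm f"
    by (metis T hardy_bounded_operator_bound)
  note D = hardy_bounded_operatorD[OF T]
  have "hardy_norm (\<lambda>z. c * T f z) \<le> (cmod c * K) * hardy_norm f" if "f \<in> hardy_space" for f
    using hardy_norm_cmult_le[OF D(1)[OF that], of c] mult_left_mono[OF K[OF that], of "cmod c"]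
    by (simp add: mult.assoc)
  then show ?thesis
    by (intro hardy_bounded_operatorI[where K = "cmod c * K"] hardy_space_cmult D(1))
      (simp_all add: D distrib_left mult_ac)
qed

lemma hardy_bounded_operator_sum:
  fixes n :: nat
  assumes "\<And>k. k < n \<Longrightarrow> hardy_bounded_operator (T k)"
  shows "hardy_bounded_operator (\<lambda>f z. \<Sum>k<n. T k f z)"
  using assms
proof (induction n)
  case (Suc n)
  then show ?case
    using hardy_bounded_operator_add[of "\<lambda>f z. \<Sum>k<n. T k f z" "T n"] by simp
qed (simp add: hardy_bounded_operator_zero)

lemma hardy_bounded_operator_minus_scalar:
  assumes "hardy_bounded_operator T"
  shows "hardy_bounded_operator (minus_scalar T c)"
  using hardy_bounded_operator_add[OF assms hardy_bounded_operator_cmult[OF hardy_bounded_operator_id, of "-c"]]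
  by (simp add: minus_scalar_def[abs_def])

text \<open>
  The cofactor of \<open>T - c\<close> in the factorization of \<open>T^n - c^n\<close>, as in the finite geometric series.
\<close>
definition geometric_cofactor :: "fun_operator \<Rightarrow> complex \<Rightarrow> nat \<Rightarrow> fun_operator" where
  "geometric_cofactor T c n f = (\<lambda>z. \<Sum>k<n. c ^ (n - 1 - k) * (T ^^ k) f z)"

lemma hardy_bounded_operator_geometric_cofactor:
  assumes "hardy_bounded_operator T"
  shows "hardy_bounded_operator (geometric_cofactor T c n)"
  unfolding geometric_cofactor_def[abs_def]
  by (intro hardy_bounded_operator_sum hardy_bounded_operator_cmult hardy_bounded_operator_funpow assms)

text \<open>
  Both products telescope. They are kept apart because one yields a left inverse of \<open>T - c\<close> and
  the other a right inverse.
\<close>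
lemma
  assumes T: "hardy_bounded_operator T" and f: "f \<in> hardy_space"
  shows geometric_cofactor_minus_scalar:
      "geometric_cofactor T c n (minus_scalar T c f) = minus_scalar (T ^^ n) (c ^ n) f"
    and minus_scalar_geometric_cofactor:
      "minus_scalar T c (geometric_cofactor T c n f) = minus_scalar (T ^^ n) (c ^ n) f"
proof -
  note Tk = hardy_bounded_operator_funpow[OF T]
  note D = hardy_bounded_operatorD[OF T f] 
  define u where "u z k = c ^ (n - k) * (T ^^ k) f z" for z k
  have step: "c ^ (n - 1 - k) * (T (( T ^^ k) f) z - c * (T ^^ k) f z) = u z (Suc k) - u z k"
    if "k < n" for z k
  proof -
    have "c ^ (n - k) = c * c ^ (n - 1 - k)"
      using that by (metis Suc_diff_Suc diff_Suc_eq_diff_pred power_Suc)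
    then show ?thesis using that by (simp add: u_def algebra_simps)
  qed
  have tele: "(\<Sum>k<n. c ^ (n - 1 - k) * (T ((T ^^ k) f) z - c * (T ^^ k) f z)) = (T ^^ n) f z - c ^ n * f z" for z
    using step by (simp add: sum_lessThan_telescope[of "u z"]) (simp add: u_def)
  have "(T ^^ k) (minus_scalar T c f) = (\<lambda>z. T ((T ^^ k) f) z - c * (T ^^ k) f z)" for k
    using hardy_bounded_operator_diff[OF Tk hardy_bounded_operatorD(1)[OF T f] hardy_space_cmult[OF f]]
      hardy_bounded_operatorD(3)[OF Tk f]
    by (simp add: minus_scalar_def flip: funpow_swap1)
  then show "geometric_cofactor T c n (minus_scalar T c f) = minus_scalar (T ^^ n) (c ^ n) f"
    by (simp only: geometric_cofactor_def tele) (simp add: minus_scalar_def)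
  have sum: "(\<lambda>z. \<Sum>k<m. d k * g k z) \<in> hardy_space \<and>
        T (\<lambda>z. \<Sum>k<m. d k * g k z) = (\<lambda>z. \<Sum>k<m. d k * T (g k) z)"
    if "\<And>k. g k \<in> hardy_space" for m :: nat and d g
  proof (induction m)
    case 0
    have "T (\<lambda>z. 0) = (\<lambda>z. 0)"
      using hardy_bounded_operatorD(3)[OF T hardy_space_zero, of 0] by simp
    then show ?case by (simp add: hardy_space_zero)
  next
    case (Suc m)
    then show ?case
      using that by (simp add: hardy_space_add hardy_space_cmult hardy_bounded_operatorD(2,3)[OF T])
  qed
  have "T (geometric_cofactor T c n f) = (\<lambda>z. \<Sum>k<n. c ^ (n - 1 - k) * T ((T ^^ k) f) z)"
    unfolding geometric_cofactor_def using sum[of "\<lambda>k. (T ^^ k) f"] hardy_bounded_operatorD(1)[OF Tk f] by simp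
  then show "minus_scalar T c (geometric_cofactor T c n f) = minus_scalar (T ^^ n) (c ^ n) f"
    by (simp add: geometric_cofactor_def minus_scalar_def fun_eq_iff right_diff_distrib sum_subtractf
        flip: tele) (simp add: sum_distrib_left mult_ac)
qed

lemma hardy_invertible_one_sided:
  assumes T: "hardy_bounded_operator T" and L: "hardy_bounded_operator L" and R: "hardy_bounded_operator R"
    and LT: "\<And>f. f \<in> hardy_space \<Longrightarrow> L (T f) = f" and TR: "\<And>f. f \<in> hardy_space \<Longrightarrow> T (R f) = f"
  shows "hardy_invertible T"
proof -
  have "R f = L f" if "f \<in> hardy_space" for f
    using LT[of "R f"] TR[OF that] hardy_bounded_operatorD(1)[OF R that] by simp
  then show ?thesis
    unfolding hardy_invertible_def using assms hardy_bounded_operatorD(1)[OF T] by force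
qed

text \<open>
  An approximate Neumann series. Let \<open>S\<close> be the inverse of \<open>T - c\<close>, with bound \<open>K\<close>. If
  \<open>|d - c| K < 1\<close>, then replacing an approximate solution \<open>f\<close> of \<open>(T - d) f = g\<close> by \<open>f + S r\<close>, where
  \<open>r\<close> is its residual, shrinks the residual by that factor. Since only density of the range is
  wanted, no limit of the approximate solutions is needed.
\<close>
lemma hardy_dense_range_near_resolvent:
  assumes T: "hardy_bounded_operator T" and inv: "hardy_invertible (minus_scalar T c)"
  obtains \<delta> where "0 < \<delta>" "\<And>d. cmod (d - c) < \<delta> \<Longrightarrow> hardy_dense (minus_scalar T d ` hardy_space)"
proof -
  from inv obtain S where S: "hardy_bounded_operator S"
    and TS: "\<And>f. f \<in> hardy_space \<Longrightarrow> minus_scalar T c (S f) = f"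
    by (auto simp: hardy_invertible_def)
  obtain K where K: "0 < K" "\<And>f. f \<in> hardy_space \<Longrightarrow> hardy_norm (S f) \<le> K * hardy_norm f"
    using hardy_bounded_operator_bound[OF S] by blast
  note DS = hardy_bounded_operatorD[OF S]
  show thesis
  proof (rule that[of "1 / K"])
    fix d assume "cmod (d - c) < 1 / K"
    then have q: "cmod (d - c) * K < 1" using K by (simp add: field_simps)
    define q where "q = cmod (d - c) * K"
    have q0: "0 \<le> q" using K by (simp add: q_def)
    note TD = hardy_bounded_operator_minus_scalar[OF T, of d]
    note D = hardy_bounded_operatorD[OF TD]
    have "\<exists>f\<in>hardy_space. hardy_norm (\<lambda>z. g z - minus_scalar T d f z) \<le> q ^ k * hardy_norm g"
      if g: "g \<in> hardy_space" for g k
    proof (induction k)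
      case 0
      have "minus_scalar T d (\<lambda>z. 0) = (\<lambda>z. 0)"
        using D(3)[OF hardy_space_zero, of 0] by simp
      then show ?case by (intro bexI[of _ "\<lambda>z. 0"] hardy_space_zero) simp
    next
      case (Suc k)
      then obtain f where f: "f \<in> hardy_space"
        and le: "hardy_norm (\<lambda>z. g z - minus_scalar T d f z) \<le> q ^ k * hardy_norm g" by auto
      define r where "r = (\<lambda>z. g z - minus_scalar T d f z)"
      have r: "r \<in> hardy_space" unfolding r_def by (intro hardy_space_diff g D f)
      have "(\<lambda>z. g z - minus_scalar T d (\<lambda>z. f z + S r z) z) = (\<lambda>z. (d - c) * S r z)"
      proof
        fix z
        have "minus_scalar T d (\<lambda>z. f z + S r z) z = minus_scalar T d f z + minus_scalar T d (S r) z"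
          using D(2)[OF f DS(1)[OF r]] by simp
        moreover have "minus_scalar T d (S r) z = r z - (d - c) * S r z"
          using fun_cong[OF TS[OF r], of z] by (simp add: minus_scalar_def algebra_simps)
        ultimately show "g z - minus_scalar T d (\<lambda>z. f z + S r z) z = (d - c) * S r z"
          by (simp add: r_def)
      qed
      moreover have "hardy_norm (\<lambda>z. (d - c) * S r z) \<le> q ^ Suc k * hardy_norm g"
      proof -
        have "hardy_norm (\<lambda>z. (d - c) * S r z) \<le> cmod (d - c) * hardy_norm (S r)"
          by (intro hardy_norm_cmult_le DS r)
        also have "\<dots> \<le> cmod (d - c) * (K * hardy_norm r)"
          by (intro mult_left_mono K r) auto
        also have "\<dots> = q * hardy_norm r" by (simp add: q_def)
        also have "\<dots> \<le> q * (q ^ k * hardy_norm g)"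
          using le q0 by (intro mult_left_mono) (auto simp: r_def)
        finally show ?thesis by simp
      qed
      ultimately show ?case
        by (intro bexI[of _ "\<lambda>z. f z + S r z"] hardy_space_add f DS r) simp
    qed
    moreover have "\<exists>k. q ^ k * hardy_norm g < \<epsilon>" if "\<epsilon> > 0" for g and \<epsilon> :: real
    proof -
      have "(\<lambda>k. q ^ k * hardy_norm g) \<longlonglongrightarrow> 0 * hardy_norm g"
        using q q0 by (intro tendsto_intros LIMSEQ_realpow_zero) (auto simp: q_def)
      then show ?thesis
        using order_tendstoD(2)[of _ "0 * hardy_norm g" sequentially \<epsilon>] that
        by (auto simp: eventually_sequentially)
    qed
    ultimately show "hardy_dense (minus_scalar T d ` hardy_space)"
      unfolding hardy_dense_def by (meson imageI le_less_trans)
  qed (use K in auto)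
qed

lemma closure_compression_spectrum_subset_spectrum:
  assumes "hardy_bounded_operator T"
  shows "closure (hardy_compression_spectrum T) \<subseteq> hardy_spectrum T"
proof
  fix c assume c: "c \<in> closure (hardy_compression_spectrum T)"
  show "c \<in> hardy_spectrum T"
  proof (rule ccontr)
    assume "c \<notin> hardy_spectrum T"
    then have "hardy_invertible (minus_scalar T c)" by (simp add: hardy_spectrum_def)
    then obtain \<delta> where "0 < \<delta>"
      and \<delta>: "\<And>d. cmod (d - c) < \<delta> \<Longrightarrow> hardy_dense (minus_scalar T d ` hardy_space)"
      using hardy_dense_range_near_resolvent[OF assms] by blast
    with c show False
      by (force simp: closure_approachable dist_norm hardy_compression_spectrum_def)
  qed
qed

section \<open>Elliptic automorphisms and orbit products\<close>

lemma funpow_mem: "\<phi> ` S \<subseteq> S \<Longrightarrow> z \<in> S \<Longrightarrow> (\<phi> ^^ k) z \<in> S"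
  by (induction k) auto

lemma holomorphic_on_funpow:
  assumes "\<phi> holomorphic_on S" "\<phi> ` S \<subseteq> S"
  shows "(\<phi> ^^ k) holomorphic_on S"
proof (induction k)
  case (Suc k)
  have "(\<phi> ^^ k) ` S \<subseteq> S" using funpow_mem[OF assms(2)] by auto
  then show ?case
    unfolding funpow.simps by (rule holomorphic_on_compose_gen[OF Suc assms(1)])
qed (simp add: holomorphic_on_id)

text \<open>
  Conjugating \<open>\<phi>\<close> by the Moebius map \<open>\<alpha>\<close> that sends \<open>a\<close> to \<open>0\<close> gives a self-map of the disk that
  fixes \<open>0\<close> and has the same derivative there. That derivative has modulus one, so
  the equality case of the Schwarz lemma makes the conjugate a rotation.
\<close>
lemma Moebius_function_linearizes:
  assumes p: "\<phi> holomorphic_on unit_disk" and self: "\<phi> ` unit_disk \<subseteq> unit_disk"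
    and a: "a \<in> unit_disk" "\<phi> a = a" and d: "cmod (deriv \<phi> a) = 1" and z: "z \<in> unit_disk"
  shows "Moebius_function 0 a (\<phi> z) = deriv \<phi> a * Moebius_function 0 a z"
proof -
  define M where "M = Moebius_function 0 a"
  define N where "N = Moebius_function 0 (-a)"
  have M: "M holomorphic_on unit_disk" "M ` unit_disk \<subseteq> unit_disk"
    and N: "N holomorphic_on unit_disk" "N ` unit_disk \<subseteq> unit_disk"
    using a by (auto simp: M_def N_def intro!: Moebius_function_holomorphic Moebius_function_norm_lt_1)
  have MN: "M (N u) = u" and NM: "N (M u) = u" if "u \<in> unit_disk" for u
    using a that unfolding M_def N_def by (auto intro!: Moebius_function_compose)
  have N0: "N 0 = a" and Ma: "M a = 0"
    by (simp_all add: N_def M_def Moebius_function_of_zero Moebius_function_eq_zero)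
  define h where "h = (M \<circ> \<phi>) \<circ> N"
  have h: "h holomorphic_on unit_disk"
    unfolding h_def by (intro holomorphic_on_compose_gen[OF _ _ N(2)] holomorphic_on_compose_gen[OF _ _ self] M N p)
  have diff: "f field_differentiable at u" if "f holomorphic_on unit_disk" "u \<in> unit_disk" for f u
    using that by (auto simp: holomorphic_on_imp_differentiable_at)
  have D0: "0 \<in> (unit_disk :: complex set)" by simp
  have Mp: "M \<circ> \<phi> holomorphic_on unit_disk" by (rule holomorphic_on_compose_gen[OF p M(1) self])
  have "deriv (M \<circ> N) 0 = deriv (\<lambda>u. u) 0"
    by (rule complex_derivative_transform_within_open[of _ unit_disk])
       (use MN in \<open>auto intro!: holomorphic_intros holomorphic_on_compose_gen[OF N(1) M(1) N(2)]\<close>)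
  then have unit: "deriv M a * deriv N 0 = 1"
    using deriv_chain[OF diff[OF N(1) D0], of M] diff[OF M(1) a(1)] by (simp add: N0)
  have "deriv h 0 = deriv (M \<circ> \<phi>) a * deriv N 0"
    unfolding h_def using deriv_chain[OF diff[OF N(1) D0], of "M \<circ> \<phi>"] diff[OF Mp a(1)] by (simp add: N0)
  also have "deriv (M \<circ> \<phi>) a = deriv M a * deriv \<phi> a"
    using deriv_chain[OF diff[OF p a(1)], of M] diff[OF M(1) a(1)] by (simp add: a)
  finally have h': "deriv h 0 = deriv \<phi> a" using unit by (simp add: mult_ac)
  have h0: "h 0 = 0" by (simp add: h_def N0 Ma a)
  have hself: "cmod (h u) < 1" if "cmod u < 1" for u
    using that N(2) self M(2) by (auto simp: h_def image_subset_iff)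
  have "\<exists>\<alpha>. (\<forall>u. cmod u < 1 \<longrightarrow> h u = \<alpha> * u) \<and> cmod \<alpha> = 1"
    using d h' by (intro Schwarz_Lemma(3)[OF h h0 hself, of 0]) auto
  then obtain \<alpha> where \<alpha>: "\<And>u. cmod u < 1 \<Longrightarrow> h u = \<alpha> * u" by auto
  have "deriv h 0 = deriv (\<lambda>u. \<alpha> * u) 0"
    by (rule complex_derivative_transform_within_open[of _ unit_disk])
       (use \<alpha> h in \<open>auto intro!: holomorphic_intros\<close>)
  then have "\<alpha> = deriv \<phi> a" using h' by simp
  moreover have "h (M z) = M (\<phi> z)" using NM[OF z] by (simp add: h_def)
  ultimately show ?thesis
    using \<alpha>[of "M z"] M(2) z by (auto simp: M_def image_subset_iff)
qed

lemma Moebius_function_eq_0_iff: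
  assumes "a \<in> unit_disk" "z \<in> unit_disk"
  shows "Moebius_function 0 a z = 0 \<longleftrightarrow> z = a"
proof
  assume "Moebius_function 0 a z = 0"
  then have "Moebius_function 0 (-a) 0 = z"
    using Moebius_function_compose[of "-a" a z] assms by auto
  then show "z = a" by (simp add: Moebius_function_of_zero)
qed (simp add: Moebius_function_eq_zero)

text \<open>
  If \<open>F = \<alpha>^m G\<close>, where \<open>\<alpha>\<close> is the linearizing Moebius map, then invariance of \<open>F\<close> forces
  \<open>\<omega>^m G(a) = G(a)\<close>. So \<open>G(a) = 0\<close> unless \<open>\<omega>^m = 1\<close>, and another factor \<open>\<alpha>\<close> splits off.
  The start \<open>m = 0\<close> is the assumption \<open>F a = 0\<close>.
\<close>
lemma invariant_function_vanishing_order: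
  assumes p: "\<phi> holomorphic_on unit_disk" and self: "\<phi> ` unit_disk \<subseteq> unit_disk"
    and a: "a \<in> unit_disk" "\<phi> a = a"
    and lin: "\<And>z. z \<in> unit_disk \<Longrightarrow> Moebius_function 0 a (\<phi> z) = \<omega> * Moebius_function 0 a z"
    and F: "F holomorphic_on unit_disk" "F a = 0" "\<And>z. z \<in> unit_disk \<Longrightarrow> F (\<phi> z) = F z"
    and \<omega>: "\<And>k. 0 < k \<Longrightarrow> k < m \<Longrightarrow> \<omega> ^ k \<noteq> 1"
  shows "\<exists>G. G holomorphic_on unit_disk \<and> (\<forall>z\<in>unit_disk. F z = Moebius_function 0 a z ^ m * G z)"
  using \<omega>
proof (induction m)
  case 0
  show ?case using F(1) by auto
next
  case (Suc m)
  let ?M = "Moebius_function 0 a"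
  obtain G where G: "G holomorphic_on unit_disk" "\<And>z. z \<in> unit_disk \<Longrightarrow> F z = ?M z ^ m * G z"
    using Suc by (metis less_SucI)
  have G0: "G a = 0"
  proof (cases "m = 0")
    case True
    then show ?thesis using G(2)[OF a(1)] F(2) by simp
  next
    case False
    define H where "H z = \<omega> ^ m * G (\<phi> z) - G z" for z
    have "H holomorphic_on unit_disk"
      unfolding H_def
      by (intro holomorphic_intros G holomorphic_on_compose_gen[OF p G(1) self, unfolded o_def])
    then have "isCont H a"
      using a(1) by (meson continuous_on_eq_continuous_at holomorphic_on_imp_continuous_on open_ball)
    then have lim: "H \<midarrow>a\<rightarrow> H a" by (simp add: isCont_def)
    have Hz: "H z = 0" if z: "z \<in> unit_disk" "z \<noteq> a" for z
    proof -
      have "?M (\<phi> z) ^ m * G (\<phi> z) = ?M z ^ m * G z"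
        using F(3)[OF z(1)] G(2)[OF z(1)] G(2)[of "\<phi> z"] self z(1)
        by (metis image_subset_iff)
      then have "?M z ^ m * H z = 0"
        by (simp add: lin[OF z(1)] H_def power_mult_distrib algebra_simps)
      then show ?thesis using Moebius_function_eq_0_iff[OF a(1) z(1)] z(2) by simp
    qed
    have "\<forall>\<^sub>F z in at a. z \<in> unit_disk - {a}"
      using eventually_at_in_open[of unit_disk a] a(1) by auto
    then have "\<forall>\<^sub>F z in at a. H z = 0" by eventually_elim (auto intro: Hz)
    then have "H \<midarrow>a\<rightarrow> 0" by (rule tendsto_eventually)
    with lim have "H a = 0" by (rule LIM_unique)
    then have "(\<omega> ^ m - 1) * G a = 0" by (simp add: H_def a algebra_simps)
    then show ?thesis using Suc.prems[of m] False by simp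
  qed
  define G' where "G' z = (1 - cnj a * z) * (if z = a then deriv G a else (G z - G a) / (z - a))" for z
  have "G' holomorphic_on unit_disk"
    unfolding G'_def by (intro holomorphic_intros pole_lemma_open G) auto
  moreover have "F z = ?M z ^ Suc m * G' z" if z: "z \<in> unit_disk" for z
  proof -
    have "1 - cnj a * z \<noteq> 0"
      using a z by (metis complex_mod_cnj eq_iff_diff_eq_0 less_irrefl mem_ball_0 norm_mult_less norm_one mult_1)
    then have "?M z * G' z = G z"
      using G0 by (auto simp: Moebius_function_simple G'_def)
    then show ?thesis using G(2)[OF z] by (simp add: mult_ac)
  qed
  ultimately show ?case by blast
qed

definition orbit_product :: "(complex \<Rightarrow> complex) \<Rightarrow> (complex \<Rightarrow> complex) \<Rightarrow> nat \<Rightarrow> complex \<Rightarrow> complex" where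
  "orbit_product \<psi> \<phi> k z = (\<Prod>j<k. \<psi> ((\<phi> ^^ j) z))"

lemma weighted_comp_funpow:
  assumes "\<phi> ` unit_disk \<subseteq> unit_disk" "z \<in> unit_disk"
  shows "(weighted_comp \<psi> \<phi> ^^ k) f z = orbit_product \<psi> \<phi> k z * f ((\<phi> ^^ k) z)"
  using assms(2)
proof (induction k arbitrary: z)
  case 0
  then show ?case by (simp add: orbit_product_def)
next
  case (Suc k)
  then have "\<phi> z \<in> unit_disk" using assms(1) by blast
  then have "(weighted_comp \<psi> \<phi> ^^ Suc k) f z =
      \<psi> z * (orbit_product \<psi> \<phi> k (\<phi> z) * f ((\<phi> ^^ k) (\<phi> z)))"
    using Suc by (simp only: funpow.simps o_apply) (simp add: weighted_comp_def[of _ _ "(weighted_comp \<psi> \<phi> ^^ k) f"])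
  moreover have "\<psi> z * orbit_product \<psi> \<phi> k (\<phi> z) = orbit_product \<psi> \<phi> (Suc k) z"
    unfolding orbit_product_def prod.lessThan_Suc_shift by (simp add: funpow_swap1)
  ultimately show ?case by (simp add: funpow_swap1 mult.assoc[symmetric])
qed

lemma orbit_product_holomorphic:
  assumes "\<psi> holomorphic_on S" "\<phi> holomorphic_on S" "\<phi> ` S \<subseteq> S"
  shows "orbit_product \<psi> \<phi> k holomorphic_on S"
proof -
  have "(\<lambda>z. \<psi> ((\<phi> ^^ j) z)) holomorphic_on S" for j
    using holomorphic_on_compose_gen[OF holomorphic_on_funpow[OF assms(2,3)] assms(1)] funpow_mem[OF assms(3)]
    by (auto simp: o_def)
  then show ?thesis unfolding orbit_product_def[abs_def] by (intro holomorphic_intros)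
qed

lemma orbit_product_invariant:
  assumes "(\<phi> ^^ n) z = z"
  shows "orbit_product \<psi> \<phi> n (\<phi> z) = orbit_product \<psi> \<phi> n z"
proof (cases n)
  case (Suc m)
  have "orbit_product \<psi> \<phi> n (\<phi> z) = (\<Prod>j<m. \<psi> ((\<phi> ^^ Suc j) z)) * \<psi> ((\<phi> ^^ n) z)"
    by (simp add: orbit_product_def Suc funpow_swap1)
  also have "\<dots> = \<psi> z * (\<Prod>j<m. \<psi> ((\<phi> ^^ Suc j) z))" by (simp only: assms mult.commute)
  also have "\<dots> = orbit_product \<psi> \<phi> n z"
    unfolding orbit_product_def Suc prod.lessThan_Suc_shift by simp
  finally show ?thesis .
qed (simp add: orbit_product_def)

text \<open>
  If the range of \<open>T - c\<close> is dense, then the functions \<open>(T^n - c^n) f\<close> come close, in norm and hence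
  uniformly on compact sets, to \<open>A g\<close> for every \<open>g\<close>, where \<open>A\<close> is the geometric cofactor. A
  density assumption is refuted below by choosing \<open>g\<close> so that \<open>A g\<close> violates a vanishing condition that all
  \<open>(T^n - c^n) f\<close> satisfy.
\<close>
lemma dense_range_approximation:
  assumes T: "hardy_bounded_operator T" and dense: "hardy_dense (minus_scalar T c ` hardy_space)"
    and g: "g \<in> hardy_space" and K: "compact K" "K \<subseteq> unit_disk" and \<epsilon>: "0 < \<epsilon>"
  obtains f where "f \<in> hardy_space"
    "\<And>z. z \<in> K \<Longrightarrow> cmod (geometric_cofactor T c n g z - minus_scalar (T ^^ n) (c ^ n) f z) < \<epsilon>"
proof -
  note A = hardy_bounded_operator_geometric_cofactor[OF T, of c n]
  note R = hardy_bounded_operator_minus_scalar[OF T, of c]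
  obtain L where L: "0 < L" "\<And>f. f \<in> hardy_space \<Longrightarrow> hardy_norm (geometric_cofactor T c n f) \<le> L * hardy_norm f"
    using hardy_bounded_operator_bound[OF A] by blast
  obtain C where C: "0 < C" "\<And>f z. f \<in> hardy_space \<Longrightarrow> z \<in> K \<Longrightarrow> cmod (f z) \<le> C * hardy_norm f"
    using norm_le_hardy_norm_on_compact[OF K] by blast
  have "0 < \<epsilon> / (C * L)" using \<epsilon> L C by simp
  then obtain f where f: "f \<in> hardy_space"
    and fg: "hardy_norm (\<lambda>z. g z - minus_scalar T c f z) < \<epsilon> / (C * L)"
    using dense g unfolding hardy_dense_def by blast
  note Rf = hardy_bounded_operatorD(1)[OF R f]
  define r where "r = (\<lambda>z. g z - minus_scalar T c f z)"
  have r: "r \<in> hardy_space" unfolding r_def by (intro hardy_space_diff g Rf)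
  have Ar: "geometric_cofactor T c n r z = geometric_cofactor T c n g z - minus_scalar (T ^^ n) (c ^ n) f z" for z
    using hardy_bounded_operator_diff[OF A g Rf] geometric_cofactor_minus_scalar[OF T f]
    by (simp add: r_def)
  show thesis
  proof (rule that[OF f])
    fix z assume z: "z \<in> K"
    have "cmod (geometric_cofactor T c n r z) \<le> C * hardy_norm (geometric_cofactor T c n r)"
      by (intro C z hardy_bounded_operatorD[OF A] r)
    also have "\<dots> \<le> C * (L * hardy_norm r)"
      using C(1) by (intro mult_left_mono L r) auto
    also have "\<dots> < \<epsilon>"
      using fg C(1) L(1) by (simp add: r_def field_simps)
    finally show "cmod (geometric_cofactor T c n g z - minus_scalar (T ^^ n) (c ^ n) f z) < \<epsilon>"
      by (simp add: Ar)
  qed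
qed

section \<open>The spectrum of a weighted composition operator\<close>

text \<open>
  The power map is open, so if values of \<open>P\<close> came close to \<open>c^n\<close>, then \<open>n\<close>-th roots of these values
  would come close to \<open>c\<close>.
\<close>
lemma root_values_bounded_away:
  fixes c :: complex and n :: nat and P :: "'a \<Rightarrow> complex"
  assumes n: "0 < n" and c: "c \<notin> closure {d. \<exists>z\<in>X. d ^ n = P z}"
  obtains \<delta> where "0 < \<delta>" "\<And>z. z \<in> X \<Longrightarrow> \<delta> \<le> cmod (P z - c ^ n)"
proof -
  from c obtain e where e: "0 < e" "\<And>d. d \<in> ball c e \<Longrightarrow> d \<notin> {d. \<exists>z\<in>X. d ^ n = P z}"
    by (auto simp: closure_approachable dist_commute)
  have "\<not> (\<lambda>d::complex. d ^ n) constant_on UNIV"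
  proof
    assume "(\<lambda>d::complex. d ^ n) constant_on UNIV"
    then have "(0::complex) ^ n = 1 ^ n" unfolding constant_on_def by (metis UNIV_I)
    with n show False by (simp add: power_0_left)
  qed
  then have "open ((\<lambda>d. d ^ n) ` ball c e)"
    by (intro open_mapping_thm[of _ UNIV]) (auto intro!: holomorphic_intros)
  moreover have "c ^ n \<in> (\<lambda>d. d ^ n) ` ball c e" using e(1) by auto
  ultimately obtain \<delta> where \<delta>: "0 < \<delta>" "ball (c ^ n) \<delta> \<subseteq> (\<lambda>d. d ^ n) ` ball c e"
    by (meson open_contains_ball)
  show thesis
  proof (rule that[OF \<delta>(1)])
    fix z assume z: "z \<in> X"
    show "\<delta> \<le> cmod (P z - c ^ n)"
    proof (rule ccontr)
      assume "\<not> \<delta> \<le> cmod (P z - c ^ n)"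
      then have "P z \<in> ball (c ^ n) \<delta>" by (simp add: dist_norm norm_minus_commute)
      with \<delta>(2) obtain d where "d \<in> ball c e" "d ^ n = P z" by auto
      with e(2) z show False by auto
    qed
  qed
qed

text \<open>
  The \<open>n\<close>-th power of the operator is multiplication by the orbit product, since \<open>\<phi>\<^sub>n\<close> is the
  identity on the disk.
\<close>
lemma minus_scalar_weighted_comp_funpow:
  assumes psi: "hardy_infinity \<psi>" and p: "\<phi> holomorphic_on unit_disk" and self: "\<phi> ` unit_disk \<subseteq> unit_disk"
    and per: "\<And>z. z \<in> unit_disk \<Longrightarrow> (\<phi> ^^ n) z = z" and f: "f \<in> hardy_space"
  shows "minus_scalar (weighted_comp \<psi> \<phi> ^^ n) b f z = (orbit_product \<psi> \<phi> n z - b) * f z"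
proof (cases "z \<in> unit_disk")
  case True
  then show ?thesis
    by (simp add: minus_scalar_def weighted_comp_funpow[OF self] per algebra_simps)
next
  case False
  have "(weighted_comp \<psi> \<phi> ^^ n) f \<in> hardy_space"
    by (intro hardy_bounded_operatorD(1)[OF _ f] hardy_bounded_operator_funpow
        hardy_bounded_operator_weighted_comp psi p self)
  then show ?thesis
    using hardy_spaceD(2)[OF f False] hardy_spaceD(2)[OF _ False, of "(weighted_comp \<psi> \<phi> ^^ n) f"]
    by (simp add: minus_scalar_def)
qed

lemma hardy_invertible_minus_scalar_weighted_comp:
  assumes psi: "hardy_infinity \<psi>" and p: "\<phi> holomorphic_on unit_disk" and self: "\<phi> ` unit_disk \<subseteq> unit_disk"
    and per: "\<And>z. z \<in> unit_disk \<Longrightarrow> (\<phi> ^^ n) z = z"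
    and \<delta>: "0 < \<delta>" "\<And>z. z \<in> unit_disk \<Longrightarrow> \<delta> \<le> cmod (orbit_product \<psi> \<phi> n z - c ^ n)"
  shows "hardy_invertible (minus_scalar (weighted_comp \<psi> \<phi>) c)"
proof -
  define T where "T = weighted_comp \<psi> \<phi>"
  define u where "u z = 1 / (orbit_product \<psi> \<phi> n z - c ^ n)" for z
  define M where "M = weighted_comp u (\<lambda>z. z)"
  define A where "A = geometric_cofactor T c n"
  have nz: "orbit_product \<psi> \<phi> n z - c ^ n \<noteq> 0" if "z \<in> unit_disk" for z
    using \<delta>(1) \<delta>(2)[OF that] by auto
  have T: "hardy_bounded_operator T"
    unfolding T_def by (intro hardy_bounded_operator_weighted_comp psi p self)
  have "cmod (u z) \<le> 1 / \<delta>" if "z \<in> unit_disk" for z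
    using \<delta>(1) \<delta>(2)[OF that] by (simp add: u_def norm_divide frac_le)
  then have "bounded (u ` unit_disk)" unfolding bounded_iff by blast
  moreover have "u holomorphic_on unit_disk"
    unfolding u_def using psi nz
    by (intro holomorphic_intros orbit_product_holomorphic p self) (auto simp: hardy_infinity_def)
  ultimately have M: "hardy_bounded_operator M"
    unfolding M_def by (intro hardy_bounded_operator_weighted_comp) (auto simp: hardy_infinity_def)
  have A: "hardy_bounded_operator A"
    unfolding A_def by (rule hardy_bounded_operator_geometric_cofactor[OF T])
  have Tn: "minus_scalar (T ^^ n) (c ^ n) f = (\<lambda>z. (orbit_product \<psi> \<phi> n z - c ^ n) * f z)"
    if "f \<in> hardy_space" for f
    unfolding T_def by (rule ext) (rule minus_scalar_weighted_comp_funpow[OF psi p self per that])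
  show ?thesis
    unfolding T_def[symmetric]
  proof (rule hardy_invertible_one_sided)
    show "hardy_bounded_operator (minus_scalar T c)"
      by (rule hardy_bounded_operator_minus_scalar[OF T])
    show "hardy_bounded_operator (\<lambda>f. M (A f))" "hardy_bounded_operator (\<lambda>f. A (M f))"
      by (rule hardy_bounded_operator_comp[OF M A] hardy_bounded_operator_comp[OF A M])+
    fix f assume f: "f \<in> hardy_space"
    show "M (A (minus_scalar T c f)) = f"
      using nz hardy_spaceD(2)[OF f]
      by (auto simp: A_def geometric_cofactor_minus_scalar[OF T f] Tn[OF f] M_def weighted_comp_def u_def)
    have Mf: "M f \<in> hardy_space" by (rule hardy_bounded_operatorD(1)[OF M f])
    show "minus_scalar T c (A (M f)) = f"
      unfolding A_def minus_scalar_geometric_cofactor[OF T Mf] Tn[OF Mf]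
      using nz hardy_spaceD(2)[OF f] by (auto simp: M_def weighted_comp_def u_def)
  qed
qed

lemma primitive_root_powers:
  fixes \<omega> x :: complex
  assumes n: "0 < n" and \<omega>: "\<omega> ^ n = 1" "\<And>k. 0 < k \<Longrightarrow> k < n \<Longrightarrow> \<omega> ^ k \<noteq> 1" and x: "x ^ n = 1"
  obtains j where "j < n" "x = \<omega> ^ j"
proof -
  have nz: "\<omega> \<noteq> 0" using n \<omega>(1) by (auto simp: power_0_left)
  have "inj_on (\<lambda>j. \<omega> ^ j) {..<n}"
  proof (rule linorder_inj_onI)
    fix i j assume "i < j" "i \<in> {..<n}" "j \<in> {..<n}"
    moreover have "\<omega> ^ j = \<omega> ^ i * \<omega> ^ (j - i)" using \<open>i < j\<close> by (simp flip: power_add)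
    ultimately show "\<omega> ^ i \<noteq> \<omega> ^ j" using \<omega>(2)[of "j - i"] nz by auto
  qed auto
  then have "card ((\<lambda>j. \<omega> ^ j) ` {..<n}) = card {z::complex. z ^ n = 1}"
    using n by (simp add: card_image card_roots_unity_eq)
  moreover have "(\<lambda>j. \<omega> ^ j) ` {..<n} \<subseteq> {z. z ^ n = 1}"
  proof clarify
    show "(\<omega> ^ j) ^ n = 1" for j
      using \<omega>(1) by (metis mult.commute power_mult power_one)
  qed
  ultimately have "(\<lambda>j. \<omega> ^ j) ` {..<n} = {z. z ^ n = 1}"
    using n by (intro card_subset_eq finite_roots_unity) auto
  then have "x \<in> (\<lambda>j. \<omega> ^ j) ` {..<n}" using x by simp
  then show thesis using that by auto
qed

lemma Moebius_function_funpow: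
  assumes self: "\<phi> ` unit_disk \<subseteq> unit_disk"
    and lin: "\<And>z. z \<in> unit_disk \<Longrightarrow> Moebius_function 0 a (\<phi> z) = \<omega> * Moebius_function 0 a z"
    and z: "z \<in> unit_disk"
  shows "Moebius_function 0 a ((\<phi> ^^ k) z) = \<omega> ^ k * Moebius_function 0 a z"
proof (induction k)
  case (Suc k)
  then show ?case using lin[OF funpow_mem[OF self z, of k]] by simp
qed simp

lemma funpow_eq_self:
  assumes self: "\<phi> ` unit_disk \<subseteq> unit_disk" and a: "a \<in> unit_disk"
    and lin: "\<And>z. z \<in> unit_disk \<Longrightarrow> Moebius_function 0 a (\<phi> z) = \<omega> * Moebius_function 0 a z"
    and \<omega>: "\<omega> ^ n = 1" and z: "z \<in> unit_disk"
  shows "(\<phi> ^^ n) z = z"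
proof -
  have "Moebius_function 0 a ((\<phi> ^^ n) z) = Moebius_function 0 a z"
    using Moebius_function_funpow[OF self lin z] \<omega> by simp
  moreover have "Moebius_function 0 (-a) (Moebius_function 0 a w) = w" if "w \<in> unit_disk" for w
    using a that by (intro Moebius_function_compose) auto
  ultimately show ?thesis using funpow_mem[OF self z] z by metis
qed

text \<open>
  Density of the range is refuted by a test function \<open>g\<close>, as described before
  \<open>dense_range_approximation\<close>. The orbit of \<open>z\<^sub>0\<close> consists of \<open>n\<close> distinct points when \<open>z\<^sub>0 \<noteq> a\<close>, and
  values at these points suffice. At the fixed point the obstruction is the order of vanishing.
\<close>
lemma in_hardy_compression_spectrum_weighted_comp:
  assumes psi: "hardy_infinity \<psi>" and p: "\<phi> holomorphic_on unit_disk" and self: "\<phi> ` unit_disk \<subseteq> unit_disk"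
    and a: "a \<in> unit_disk" "\<phi> a = a"
    and lin: "\<And>z. z \<in> unit_disk \<Longrightarrow> Moebius_function 0 a (\<phi> z) = \<omega> * Moebius_function 0 a z"
    and n: "0 < n" and \<omega>: "\<omega> ^ n = 1" "\<And>k. 0 < k \<Longrightarrow> k < n \<Longrightarrow> \<omega> ^ k \<noteq> 1"
    and z0: "z0 \<in> unit_disk" "c ^ n = orbit_product \<psi> \<phi> n z0"
  shows "c \<in> hardy_compression_spectrum (weighted_comp \<psi> \<phi>)"
proof (rule ccontr)
  let ?M = "Moebius_function 0 a"
  define T where "T = weighted_comp \<psi> \<phi>"
  assume "c \<notin> hardy_compression_spectrum (weighted_comp \<psi> \<phi>)"
  then have dense: "hardy_dense (minus_scalar T c ` hardy_space)"
    by (simp add: hardy_compression_spectrum_def T_def)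
  have T: "hardy_bounded_operator T"
    unfolding T_def by (intro hardy_bounded_operator_weighted_comp psi p self)
  note approx = dense_range_approximation[OF T dense]
  have mem: "(\<phi> ^^ k) z \<in> unit_disk" if "z \<in> unit_disk" for k z
    using funpow_mem[OF self that] .
  have link: "?M ((\<phi> ^^ k) z) = \<omega> ^ k * ?M z" if "z \<in> unit_disk" for k z
    by (rule Moebius_function_funpow[OF self lin that])
  have per: "(\<phi> ^^ n) z = z" if "z \<in> unit_disk" for z
    by (rule funpow_eq_self[OF self a(1) lin \<omega>(1) that])
  have M0: "?M z = 0 \<longleftrightarrow> z = a" if "z \<in> unit_disk" for z
    by (rule Moebius_function_eq_0_iff[OF a(1) that])
  have Mball: "?M z \<in> unit_disk" if "z \<in> unit_disk" for z
    using Moebius_function_norm_lt_1 a(1) that by simp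
  have Mhol: "?M holomorphic_on unit_disk"
    using a(1) by (intro Moebius_function_holomorphic) simp
  have Tn: "minus_scalar (T ^^ n) (c ^ n) f z = (orbit_product \<psi> \<phi> n z - c ^ n) * f z"
    if "f \<in> hardy_space" for f z
    unfolding T_def by (rule minus_scalar_weighted_comp_funpow[OF psi p self per that])
  have cof: "geometric_cofactor T c m g z =
      (\<Sum>k<m. c ^ (m - 1 - k) * (orbit_product \<psi> \<phi> k z * g ((\<phi> ^^ k) z)))" if "z \<in> unit_disk" for m g z
    unfolding geometric_cofactor_def T_def by (simp add: weighted_comp_funpow[OF self that])
  consider "c = 0" | "c \<noteq> 0" "z0 \<noteq> a" | "c \<noteq> 0" "z0 = a" by blast
  then show False
  proof cases
    case 1
    then have "orbit_product \<psi> \<phi> n z0 = 0" using z0(2) n by (simp add: power_0_left)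
    then obtain k where k: "\<psi> ((\<phi> ^^ k) z0) = 0" by (auto simp: orbit_product_def)
    define w where "w = (\<phi> ^^ k) z0"
    have w: "w \<in> unit_disk" "\<psi> w = 0" using mem[OF z0(1)] k by (auto simp: w_def)
    have g: "(\<lambda>z. if z \<in> unit_disk then 1 else 0) \<in> hardy_space"
      by (rule hardy_space_bounded_holomorphic) (auto simp: hardy_infinity_def bounded_iff)
    \<comment> \<open>For exponent \<open>1\<close> the cofactor is the identity, so this is plain approximation of \<open>1\<close> by \<open>T f\<close>.\<close>
    obtain f where "cmod (geometric_cofactor T c 1 (\<lambda>z. if z \<in> unit_disk then 1 else 0) w
        - minus_scalar (T ^^ 1) (c ^ 1) f w) < 1"
      using approx[OF g, of "{w}" 1 1] w(1) by auto
    moreover have "T f w = 0" using w by (simp add: T_def weighted_comp_def)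
    ultimately show False using w(1) 1 cof[OF w(1), of 1] by (simp add: minus_scalar_def orbit_product_def)
  next
    case 2
    \<comment> \<open>A polynomial that vanishes on the rest of the orbit leaves only the term \<open>k = 0\<close> of the cofactor.\<close>
    define q where "q z = (\<Prod>k\<in>{1..<n}. z - (\<phi> ^^ k) z0)" for z
    define g where "g z = (if z \<in> unit_disk then q z else 0)" for z
    have "compact (q ` cball 0 1)"
      unfolding q_def by (intro compact_continuous_image continuous_intros) auto
    then have "bounded (q ` unit_disk)"
      using ball_subset_cball by (meson bounded_subset compact_imp_bounded image_mono)
    moreover have "q holomorphic_on unit_disk"
      unfolding q_def by (intro holomorphic_intros)
    ultimately have g: "g \<in> hardy_space"
      unfolding g_def[abs_def] by (intro hardy_space_bounded_holomorphic) (simp add: hardy_infinity_def)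
    have "q z0 \<noteq> 0"
    proof -
      have "z0 \<noteq> (\<phi> ^^ k) z0" if "k \<in> {1..<n}" for k
        using link[OF z0(1), of k] M0[OF z0(1)] 2(2) \<omega>(2)[of k] that by auto
      then show ?thesis by (simp add: q_def)
    qed
    then have ne: "c ^ (n - 1) * g z0 \<noteq> 0" using 2(1) z0(1) by (simp add: g_def)
    have "g ((\<phi> ^^ k) z0) = 0" if "k \<in> {1..<n}" for k
      using that by (auto simp: g_def q_def)
    moreover have "{..<n} = insert 0 {1..<n}" using n by auto
    ultimately have "geometric_cofactor T c n g z0 = c ^ (n - 1) * g z0"
      by (simp add: cof[OF z0(1)] orbit_product_def)
    moreover obtain f where "f \<in> hardy_space"
      "cmod (geometric_cofactor T c n g z0 - minus_scalar (T ^^ n) (c ^ n) f z0) < cmod (c ^ (n - 1) * g z0)"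
      using approx[OF g, of "{z0}" "cmod (c ^ (n - 1) * g z0)" n] z0(1) ne by auto
    moreover have "minus_scalar (T ^^ n) (c ^ n) f z0 = 0" if "f \<in> hardy_space" for f
      using Tn[OF that] z0(2) by simp
    ultimately show False by simp
  next
    case 3
    define F where "F z = orbit_product \<psi> \<phi> n z - c ^ n" for z
    have phia: "(\<phi> ^^ k) a = a" for k by (induction k) (simp_all add: a)
    have opa: "orbit_product \<psi> \<phi> k a = \<psi> a ^ k" for k by (simp add: orbit_product_def phia)
    have pa: "\<psi> a \<noteq> 0" using 3 z0(2) n by (auto simp: opa power_0_left)
    have "(c / \<psi> a) ^ n = 1" using 3 z0(2) pa by (simp add: opa power_divide)
    then obtain j where j: "j < n" "c / \<psi> a = \<omega> ^ j"
      using primitive_root_powers[OF n \<omega>] by blast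
    have c: "c = \<psi> a * \<omega> ^ j" using j(2) pa by (simp add: field_simps)
    have ophol: "orbit_product \<psi> \<phi> k holomorphic_on unit_disk" for k
      using psi by (intro orbit_product_holomorphic p self) (simp add: hardy_infinity_def)
    \<comment> \<open>Order \<open>j + 1\<close> is all that is needed to beat the test function \<open>\<alpha>^j\<close>.\<close>
    have "\<exists>G. G holomorphic_on unit_disk \<and> (\<forall>z\<in>unit_disk. F z = ?M z ^ Suc j * G z)"
    proof (rule invariant_function_vanishing_order[OF p self a lin])
      show "F holomorphic_on unit_disk" unfolding F_def by (intro holomorphic_intros ophol)
      show "F a = 0" using z0 3 by (simp add: F_def)
      show "F (\<phi> z) = F z" if "z \<in> unit_disk" for z
        by (simp add: F_def orbit_product_invariant[OF per[OF that]])
      show "\<omega> ^ k \<noteq> 1" if "0 < k" "k < Suc j" for k using \<omega>(2) that j(1) by auto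
    qed auto
    then obtain G where G: "G holomorphic_on unit_disk"
      "\<And>z. z \<in> unit_disk \<Longrightarrow> F z = ?M z ^ Suc j * G z" by blast
    define g where "g z = (if z \<in> unit_disk then ?M z ^ j else 0)" for z
    have "cmod (?M z ^ j) \<le> 1" if "z \<in> unit_disk" for z
      using Mball[OF that] by (simp add: norm_power power_le_one)
    then have "bounded ((\<lambda>z. ?M z ^ j) ` unit_disk)"
      unfolding bounded_iff by blast
    then have g: "g \<in> hardy_space"
      unfolding g_def[abs_def]
      by (intro hardy_space_bounded_holomorphic) (auto simp: hardy_infinity_def intro!: holomorphic_intros Mhol)
    define Q where "Q z = (\<Sum>k<n. c ^ (n - 1 - k) * (orbit_product \<psi> \<phi> k z * \<omega> ^ (k * j)))" for z
    have Q: "geometric_cofactor T c n g z = ?M z ^ j * Q z" if z: "z \<in> unit_disk" for z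
      using mem[OF z]
      by (simp add: cof[OF z] g_def link[OF z] Q_def sum_distrib_left power_mult power_mult_distrib mult_ac)
    have "Q a = (\<Sum>k<n. c ^ (n - 1))"
      unfolding Q_def
    proof (intro sum.cong refl)
      fix k assume "k \<in> {..<n}"
      then have "c ^ (n - 1) = c ^ (n - 1 - k) * c ^ k" by (simp flip: power_add)
      then show "c ^ (n - 1 - k) * (orbit_product \<psi> \<phi> k a * \<omega> ^ (k * j)) = c ^ (n - 1)"
        by (simp add: opa c power_mult_distrib power_mult mult.commute[of k j])
    qed
    then have Qa: "Q a \<noteq> 0" using 3(1) n by simp
    define \<rho> where "\<rho> = (1 - cmod a) / 2"
    have \<rho>: "0 < \<rho>" using a(1) by (simp add: \<rho>_def)
    have sub: "cball a \<rho> \<subseteq> unit_disk"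
    proof
      fix z assume "z \<in> cball a \<rho>"
      then have "cmod (z - a) \<le> \<rho>" by (simp add: dist_norm norm_minus_commute)
      then have "cmod z \<le> cmod a + \<rho>" using norm_triangle_sub[of z a] by simp
      then show "z \<in> unit_disk" using a(1) by (simp add: \<rho>_def field_simps)
    qed
    have sub': "sphere a \<rho> \<subseteq> unit_disk" using sub sphere_cball by blast
    have "continuous_on (sphere a \<rho>) (\<lambda>z. cmod (?M z ^ j))"
      by (intro continuous_intros holomorphic_on_imp_continuous_on holomorphic_on_subset[OF Mhol sub'])
    moreover have "sphere a \<rho> \<noteq> {}" using \<rho> by simp
    ultimately obtain z1 where z1: "z1 \<in> sphere a \<rho>"
      "\<And>z. z \<in> sphere a \<rho> \<Longrightarrow> cmod (?M z1 ^ j) \<le> cmod (?M z ^ j)"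
      using continuous_attains_inf[of "sphere a \<rho>"] by (metis compact_sphere)
    define m where "m = cmod (?M z1 ^ j)"
    have m: "0 < m"
    proof -
      have "z1 \<noteq> a" "z1 \<in> unit_disk" using z1(1) sub' \<rho> by auto
      then show ?thesis using M0 by (simp add: m_def)
    qed
    obtain f where f: "f \<in> hardy_space" and le: "\<And>z. z \<in> sphere a \<rho> \<Longrightarrow>
        cmod (geometric_cofactor T c n g z - minus_scalar (T ^^ n) (c ^ n) f z) < m * (cmod (Q a) / 2)"
      using approx[OF g compact_sphere sub', of "m * (cmod (Q a) / 2)" n] m Qa by auto
    \<comment> \<open>Dividing \<open>A g - (T^n - c^n) f\<close> by \<open>\<alpha>^j\<close> leaves \<open>D\<close>, whose value at \<open>a\<close> is \<open>Q a\<close> whatever \<open>f\<close> is;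
      the maximum principle on a circle around \<open>a\<close> bounds this value by the approximation error.\<close>
    define D where "D z = Q z - ?M z * G z * f z" for z
    have D: "D holomorphic_on unit_disk"
      unfolding D_def Q_def by (intro holomorphic_intros Mhol G ophol hardy_spaceD[OF f])
    have "cmod (D a) \<le> cmod (Q a) / 2"
    proof (rule maximum_modulus_frontier[of D "cball a \<rho>"])
      show "D holomorphic_on interior (cball a \<rho>)"
        using D sub interior_subset by (meson holomorphic_on_subset)
      show "continuous_on (closure (cball a \<rho>)) D"
        using holomorphic_on_imp_continuous_on[OF holomorphic_on_subset[OF D sub]] by simp
      show "a \<in> cball a \<rho>" using \<rho> by simp
      fix z assume "z \<in> frontier (cball a \<rho>)"
      then have z: "z \<in> sphere a \<rho>" by simp
      then have zD: "z \<in> unit_disk" using sub' by blast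
      have "?M z ^ j * D z = geometric_cofactor T c n g z - minus_scalar (T ^^ n) (c ^ n) f z"
        using G(2)[OF zD] by (simp add: Q[OF zD] Tn[OF f] D_def F_def algebra_simps)
      then have "cmod (?M z ^ j) * cmod (D z) < m * (cmod (Q a) / 2)"
        using le[OF z] by (simp flip: norm_mult)
      moreover have "m * cmod (D z) \<le> cmod (?M z ^ j) * cmod (D z)"
        using z1(2)[OF z] by (intro mult_right_mono) (auto simp: m_def)
      ultimately have "m * cmod (D z) < m * (cmod (Q a) / 2)" by linarith
      then show "cmod (D z) \<le> cmod (Q a) / 2" using m by simp
    qed simp
    moreover have "D a = Q a" by (simp add: D_def Moebius_function_eq_zero)
    ultimately show False using Qa by simp
  qed
qed

theorem theorem2p3p1:
  fixes \<phi> \<psi> :: "complex \<Rightarrow> complex" and a :: complex and n\<^sub>0 :: nat and \<Lambda> :: "complex set"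
  assumes "elliptic_automorphism \<phi>"
    and "a \<in> unit_disk" and "\<phi> a = a"
    and "hardy_infinity \<psi>" and "\<exists>z\<in>unit_disk. \<psi> z \<noteq> 0"
    and "\<not> hardy_invertible (weighted_comp \<psi> \<phi>)"
    and "\<exists>n>0. deriv \<phi> a ^ n = 1"
    and "n\<^sub>0 = (LEAST n. n > 0 \<and> deriv \<phi> a ^ n = 1)"
    and "\<Lambda> = {c. \<exists>z\<in>unit_disk. c ^ n\<^sub>0 = (\<Prod>k<n\<^sub>0. \<psi> ((\<phi> ^^ k) z))}"
  shows "hardy_spectrum (weighted_comp \<psi> \<phi>) = closure \<Lambda> \<and>
         \<Lambda> \<subseteq> hardy_compression_spectrum (weighted_comp \<psi> \<phi>)"
proof -
  let ?T = "weighted_comp \<psi> \<phi>"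
  have p: "\<phi> holomorphic_on unit_disk" and self: "\<phi> ` unit_disk \<subseteq> unit_disk"
    using assms(1) by (auto simp: elliptic_automorphism_def disk_automorphism_def bij_betw_def)
  have n: "0 < n\<^sub>0" and \<omega>: "deriv \<phi> a ^ n\<^sub>0 = 1"
    using LeastI_ex[OF assms(7)] unfolding assms(8) by auto
  have least: "deriv \<phi> a ^ k \<noteq> 1" if "0 < k" "k < n\<^sub>0" for k
    using not_less_Least[of k] that unfolding assms(8) by blast
  have "cmod (deriv \<phi> a) = 1"
    using \<omega> n by (metis norm_ge_zero norm_one norm_power power_eq_1_iff zero_less_iff_neq_zero)
  note lin = Moebius_function_linearizes[OF p self assms(2,3) this]
  have per: "(\<phi> ^^ n\<^sub>0) z = z" if "z \<in> unit_disk" for z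
    by (rule funpow_eq_self[OF self assms(2) lin \<omega> that])
  have \<Lambda>: "\<Lambda> = {c. \<exists>z\<in>unit_disk. c ^ n\<^sub>0 = orbit_product \<psi> \<phi> n\<^sub>0 z}"
    by (simp add: assms(9) orbit_product_def)
  have comp: "\<Lambda> \<subseteq> hardy_compression_spectrum ?T"
    unfolding \<Lambda>
    using in_hardy_compression_spectrum_weighted_comp[OF assms(4) p self assms(2,3) lin n \<omega> least] by auto
  have T: "hardy_bounded_operator ?T"
    by (rule hardy_bounded_operator_weighted_comp[OF assms(4) p self])
  have "closure \<Lambda> \<subseteq> hardy_spectrum ?T"
    using closure_mono[OF comp] closure_compression_spectrum_subset_spectrum[OF T] by blast
  moreover have "c \<in> closure \<Lambda>" if "c \<in> hardy_spectrum ?T" for c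
  proof (rule ccontr)
    assume "c \<notin> closure \<Lambda>"
    then obtain \<delta> where \<delta>: "0 < \<delta>" "\<And>z. z \<in> unit_disk \<Longrightarrow> \<delta> \<le> cmod (orbit_product \<psi> \<phi> n\<^sub>0 z - c ^ n\<^sub>0)"
      using root_values_bounded_away[OF n, of c unit_disk "orbit_product \<psi> \<phi> n\<^sub>0"] unfolding \<Lambda> by blast
    have "hardy_invertible (minus_scalar ?T c)"
      by (rule hardy_invertible_minus_scalar_weighted_comp[OF assms(4) p self per \<delta>])
    with that show False by (simp add: hardy_spectrum_def)
  qed
  ultimately show ?thesis using comp by blast
qed

end
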